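(* Let $k\ge2$ be an integer. For each $e\in(0,1)$ there is a unique $\tilde e\in(0,1)$ with $\partial\psi_k(e,\tilde e)/\partial\tilde e=0$; denote it $\tilde e=\zeta_k(e)$. The function $\zeta_k:(0,1)\to(0,1)$ is strictly decreasing, its derivative never vanishes, and its fixed point is $e=(k-1)/k$. Furthermore $\zeta_k$ is an involution: $\tilde e=\zeta_k(e)$ if and only if $e=\zeta_k(\tilde e)$.
   Context: Let $S_0(w)=-\frac12[w\log w+(1-w)\log(1-w)]$ for $w\in(0,1)$. For $e,\tilde e\in(0,1)$ define $\psi_k(e,\tilde e)=\frac{2[S_0(\tilde e)-S_0(e)-S_0'(e)(\tilde e-e)]}{\tilde e^k-e^k-ke^{k-1}(\tilde e-e)}$ when $\tilde e\ne e$, and $\psi_k(e,e)=\frac{2S_0''(e)}{k(k-1)e^{k-2}}$ (filling the removable singularity). *)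

theory Defs
  imports "HOL-Analysis.Analysis"
begin

definition S0 :: "real \<Rightarrow> real" where
  "S0 w = - (1 / 2) * (w * ln w + (1 - w) * ln (1 - w))"

text \<open>Only arguments in the open unit interval matter. The first branch fills the
  removable singularity on the diagonal.\<close>

definition psi :: "nat \<Rightarrow> real \<Rightarrow> real \<Rightarrow> real" where
  "psi k e e' =
     (if e' = e
      then 2 * deriv (deriv S0) e / (real k * (real k - 1) * e ^ (k - 2))
      else 2 * (S0 e' - S0 e - deriv S0 e * (e' - e)) /
           (e' ^ k - e ^ k - real k * e ^ (k - 1) * (e' - e)))"

text \<open>The partial derivative in the second argument exists at \<open>e'\<close> and is zero; stating this
  by \<open>deriv\<close> alone would leave open whether the derivative exists.\<close>

definition critical :: "nat \<Rightarrow> real \<Rightarrow> real \<Rightarrow> bool" where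
  "critical k e e' \<longleftrightarrow> ((\<lambda>x. psi k e x) has_real_derivative 0) (at e')"

definition zeta :: "nat \<Rightarrow> real \<Rightarrow> real" where
  "zeta k e = (THE e'. e' \<in> {0<..<1} \<and> critical k e e')"

end

theory Submission
  imports Defs "HOL-Real_Asymp.Real_Asymp"
begin

text \<open>Put \<open>f = 2 * S0\<close>, \<open>g w = w ^ k\<close>, and let \<open>N e x\<close> and \<open>D e x\<close> be their Bregman divergences, so that
  \<open>psi k e x = N e x / D e x\<close>. For \<open>x \<noteq> e\<close> the critical points are the zeros of the Wronskian \<open>H e x\<close>
  of \<open>N e\<close> and \<open>D e\<close>, which is symmetric in \<open>e\<close> and \<open>x\<close>; hence the involution. Such a zero means
  that some \<open>M = N e - \<beta> * D e\<close> has double zeros at both \<open>e\<close> and \<open>x\<close>. Since \<open>M'' = g'' * (r - \<beta>)\<close>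
  where \<open>r = f'' / g''\<close> increases up to \<open>m = (k - 1) / k\<close> and decreases afterwards, counting sign
  changes forces \<open>e\<close> and \<open>x\<close> to lie on opposite sides of \<open>m\<close> and both partial derivatives of \<open>H\<close>
  to be negative there (for \<open>e < x\<close>). This gives uniqueness, monotonicity, and, by implicit
  differentiation, a nonzero derivative away from \<open>m\<close>. At \<open>m\<close>, where \<open>H\<close> degenerates, Rolle's theorem
  shows that the midpoint of a pair of double zeros is \<open>m + o(x - e)\<close>, so the derivative is \<open>-1\<close>.
  On the diagonal, the derivative of \<open>psi\<close> is \<open>r' e / 3\<close> by l'Hopital's rule.\<close>

subsection \<open>Real functions of one variable\<close>

text \<open>\<open>F\<close> dips below zero just after \<open>x0\<close>. If it were nonnegative at
  \<open>y\<close>, it would have a first zero \<open>t\<close> after the dip; the negative slope at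
  \<open>t\<close> makes \<open>F\<close> positive just before \<open>t\<close>, hence an even
  earlier zero.\<close>

lemma negative_slope_zero_right:
  fixes F F' :: "real \<Rightarrow> real"
  assumes der: "\<And>x. \<lbrakk>a < x; x < b\<rbrakk> \<Longrightarrow> (F has_real_derivative F' x) (at x)"
    and neg: "\<And>x. \<lbrakk>a < x; x < b; F x = 0\<rbrakk> \<Longrightarrow> F' x < 0"
    and x0: "a < x0" "F x0 = 0" and y: "x0 < y" "y < b"
  shows "F y < 0"
proof (rule ccontr)
  assume "\<not> F y < 0"
  then have Fy: "F y \<ge> 0" by simp
  have cont: "continuous_on {p..q} F" if "a < p" "q < b" for p q
    by (intro continuous_at_imp_continuous_on ballI DERIV_isCont[OF der]) (use that in auto)
  have "F' x0 < 0" using neg x0 y by simp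
  then obtain d where d: "d > 0" "\<And>h. \<lbrakk>h > 0; h < d\<rbrakk> \<Longrightarrow> F (x0 + h) < F x0"
    using DERIV_neg_dec_right[of F "F' x0" x0] der[of x0] x0 y by auto
  define h where "h = min d (y - x0) / 2"
  have h: "h > 0" "h < d" "h < y - x0" using d(1) y by (auto simp: h_def)
  define p where "p = x0 + h"
  have p: "x0 < p" "p < y" "F p < 0"
    using d(2)[OF h(1,2)] h x0 by (simp_all add: p_def)
  define S where "S = {z \<in> {p..y}. F z = 0}"
  have "\<exists>z\<ge>p. z \<le> y \<and> F z = 0"
    by (rule IVT') (use p Fy x0 y cont in auto)
  then have "S \<noteq> {}" by (auto simp: S_def)
  moreover have "compact S"
  proof -
    have "closed S" unfolding S_def
      using continuous_closed_preimage_constant[of "{p..y}" F 0] cont[of p y] p x0 y by auto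
    moreover have "bounded S" by (rule bounded_subset[of "{p..y}"]) (auto simp: S_def)
    ultimately show ?thesis by (simp add: compact_eq_bounded_closed)
  qed
  ultimately obtain t where t: "t \<in> S" "\<And>z. z \<in> S \<Longrightarrow> t \<le> z"
    using compact_attains_inf by metis
  have t': "p < t" "t \<le> y" "F t = 0" using t(1) p by (auto simp: S_def le_less)
  then have "F' t < 0" using neg[of t] x0 p y by simp
  then obtain d' where d': "d' > 0" "\<And>h. \<lbrakk>h > 0; h < d'\<rbrakk> \<Longrightarrow> F (t - h) > F t"
    using DERIV_neg_dec_left[of F "F' t" t] der[of t] x0 y p t' by auto
  define h' where "h' = min d' (t - p) / 2"
  have h': "h' > 0" "h' < d'" "h' < t - p" using d'(1) t' by (auto simp: h'_def)
  define q where "q = t - h'"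
  have q: "p < q" "q < t" "F q > 0"
    using d'(2)[OF h'(1,2)] h' t' by (simp_all add: q_def)
  have "\<exists>z\<ge>p. z \<le> q \<and> F z = 0"
    by (rule IVT') (use p q t' x0 y cont in auto)
  then obtain z where "p \<le> z" "z \<le> q" "F z = 0" by blast
  then have "z \<in> S" "z < t" using q t' by (auto simp: S_def)
  then show False using t(2) by fastforce
qed

text \<open>The point reflection \<open>- F (- x)\<close> preserves slopes and exchanges left and
  right.\<close>

lemma negative_slope_zero_left:
  fixes F F' :: "real \<Rightarrow> real"
  assumes der: "\<And>x. \<lbrakk>a < x; x < b\<rbrakk> \<Longrightarrow> (F has_real_derivative F' x) (at x)"
    and neg: "\<And>x. \<lbrakk>a < x; x < b; F x = 0\<rbrakk> \<Longrightarrow> F' x < 0"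
    and x0: "x0 < b" "F x0 = 0" and y: "a < y" "y < x0"
  shows "F y > 0"
proof -
  have "- F (- (- y)) < 0"
  proof (rule negative_slope_zero_right[where a="-b" and b="-a" and F="\<lambda>x. - F (- x)"
        and F'="\<lambda>x. F' (- x)" and ?x0.0="- x0"])
    fix x assume "- b < x" "x < - a"
    then show "((\<lambda>x. - F (- x)) has_real_derivative F' (- x)) (at x)"
      using DERIV_minus[OF DERIV_chain2[of F "F' (- x)" "\<lambda>x. - x" x "-1"]] der[of "- x"]
      by (simp add: DERIV_minus[OF DERIV_ident])
  qed (use neg x0 y in auto)
  then show ?thesis by simp
qed

text \<open>A point with \<open>M1 y >= 0\<close> would keep \<open>M1\<close> from falling before
  it and from rising after it, so the mean value theorem would give \<open>M2 u >= 0\<close>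
  followed by \<open>M2 v <= 0\<close>, against \<open>up\<close>.\<close>

lemma slope_neg_if_upcrossing:
  fixes M M1 M2 :: "real \<Rightarrow> real"
  assumes "e < x"
    and d1: "\<And>w. \<lbrakk>e \<le> w; w \<le> x\<rbrakk> \<Longrightarrow> (M has_real_derivative M1 w) (at w)"
    and d2: "\<And>w. \<lbrakk>e \<le> w; w \<le> x\<rbrakk> \<Longrightarrow> (M1 has_real_derivative M2 w) (at w)"
    and ends: "M1 e \<le> 0" "M1 x \<le> 0"
    and up: "\<And>u v. \<lbrakk>e < u; u < v; v < x; M2 u \<ge> 0\<rbrakk> \<Longrightarrow> M2 v > 0"
  shows "M x < M e"
proof -
  obtain y where y: "e < y" "y < x" "M x - M e = (x - e) * M1 y"
    using MVT2[OF \<open>e < x\<close>, of M M1] d1 by blast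
  have "M1 y < 0"
  proof (rule ccontr)
    assume "\<not> M1 y < 0"
    moreover obtain u where u: "e < u" "u < y" "M1 y - M1 e = (y - e) * M2 u"
      using MVT2[OF y(1), of M1 M2] d2 y by (metis less_imp_le order_trans)
    moreover obtain v where v: "y < v" "v < x" "M1 x - M1 y = (x - y) * M2 v"
      using MVT2[OF y(2), of M1 M2] d2 y by (metis less_imp_le order_trans)
    ultimately have "(y - e) * M2 u \<ge> 0" "(x - y) * M2 v \<le> 0" using ends by auto
    then have "M2 u \<ge> 0" "M2 v \<le> 0" using y by (auto simp: zero_le_mult_iff mult_le_0_iff)
    then show False using up[of u v] u v by fastforce
  qed
  then show ?thesis using y by (smt (verit) mult_pos_neg)
qed

lemma slope_pos_if_downcrossing:
  fixes M M1 M2 :: "real \<Rightarrow> real"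
  assumes "e < x"
    and d1: "\<And>w. \<lbrakk>e \<le> w; w \<le> x\<rbrakk> \<Longrightarrow> (M has_real_derivative M1 w) (at w)"
    and d2: "\<And>w. \<lbrakk>e \<le> w; w \<le> x\<rbrakk> \<Longrightarrow> (M1 has_real_derivative M2 w) (at w)"
    and ends: "M1 e \<ge> 0" "M1 x \<ge> 0"
    and down: "\<And>u v. \<lbrakk>e < u; u < v; v < x; M2 u \<le> 0\<rbrakk> \<Longrightarrow> M2 v < 0"
  shows "M x > M e"
  using slope_neg_if_upcrossing[of e x "\<lambda>w. - M w" "\<lambda>w. - M1 w" "\<lambda>w. - M2 w"] assms
  by (simp add: DERIV_minus)

text \<open>The hypothesis asks for a linear relation between the increments up to an error of
  smaller order. This covers regular points of a level set as well as the degenerate point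
  \<open>m\<close>.\<close>

lemma implicit_has_real_derivative:
  fixes z :: "real \<Rightarrow> real"
  assumes cont: "isCont z e" and "\<beta> \<noteq> 0"
    and lin: "\<And>\<epsilon>. \<epsilon> > 0 \<Longrightarrow> \<exists>\<delta>>0. \<forall>y. \<bar>y - e\<bar> < \<delta> \<and> \<bar>z y - z e\<bar> < \<delta> \<longrightarrow>
       \<bar>\<alpha> * (y - e) + \<beta> * (z y - z e)\<bar> \<le> \<epsilon> * (\<bar>y - e\<bar> + \<bar>z y - z e\<bar>)"
  shows "(z has_real_derivative - \<alpha> / \<beta>) (at e)"
proof -
  define B where "B = \<bar>\<beta>\<bar>"
  \<comment> \<open>\<open>K\<close> is the constant in \<open>|h| + |l| <= K * |h|\<close>,
    obtained by absorbing half of \<open>B * |l|\<close>; the bound \<open>B / 2\<close> on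
    \<open>\<eta>\<close> makes this possible.\<close>
  define K where "K = 1 + 2 * (\<bar>\<alpha>\<bar> + B) / B"
  have B: "B > 0" using assms by (simp add: B_def)
  have K: "K > 0" using B by (simp add: K_def add_pos_nonneg)
  have "((\<lambda>y. (z y - z e) / (y - e)) \<longlongrightarrow> - \<alpha> / \<beta>) (at e)"
    unfolding LIM_eq
  proof (intro allI impI)
    fix \<epsilon> :: real assume \<epsilon>: "\<epsilon> > 0"
    define \<eta> where "\<eta> = min (B / 2) (\<epsilon> * B / (2 * K))"
    have \<eta>: "\<eta> > 0" "\<eta> \<le> B / 2" "\<eta> * K \<le> \<epsilon> * B / 2" using \<epsilon> B K
      by (auto simp: \<eta>_def min_def field_simps)
    obtain \<delta> where \<delta>: "\<delta> > 0" "\<And>y. \<lbrakk>\<bar>y - e\<bar> < \<delta>; \<bar>z y - z e\<bar> < \<delta>\<rbrakk> \<Longrightarrow>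
       \<bar>\<alpha> * (y - e) + \<beta> * (z y - z e)\<bar> \<le> \<eta> * (\<bar>y - e\<bar> + \<bar>z y - z e\<bar>)"
      using lin[OF \<eta>(1)] by blast
    obtain \<delta>' where \<delta>': "\<delta>' > 0" "\<And>y. \<bar>y - e\<bar> < \<delta>' \<Longrightarrow> \<bar>z y - z e\<bar> < \<delta>"
      using cont \<delta>(1) by (auto simp: continuous_at_eps_delta dist_real_def)
    show "\<exists>s>0. \<forall>y. y \<noteq> e \<and> norm (y - e) < s \<longrightarrow>
      norm ((z y - z e) / (y - e) - - \<alpha> / \<beta>) < \<epsilon>"
    proof (intro exI[of _ "min \<delta> \<delta>'"] conjI allI impI)
      show "min \<delta> \<delta>' > 0" using \<delta> \<delta>' by simp
      fix y assume y: "y \<noteq> e \<and> norm (y - e) < min \<delta> \<delta>'"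
      define h l where "h = y - e" and "l = z y - z e"
      have h: "\<bar>h\<bar> > 0" using y by (simp add: h_def)
      have b: "\<bar>\<alpha> * h + \<beta> * l\<bar> \<le> \<eta> * (\<bar>h\<bar> + \<bar>l\<bar>)"
        using \<delta>(2)[of y] \<delta>'(2)[of y] y by (simp add: h_def l_def)
      have "B * \<bar>l\<bar> = \<bar>\<beta> * l\<bar>" by (simp add: B_def abs_mult)
      also have "\<dots> \<le> \<bar>\<alpha> * h + \<beta> * l\<bar> + \<bar>\<alpha>\<bar> * \<bar>h\<bar>"
        using abs_triangle_ineq4[of "\<alpha> * h + \<beta> * l" "\<alpha> * h"] by (simp add: abs_mult)
      also have "\<dots> \<le> B / 2 * (\<bar>h\<bar> + \<bar>l\<bar>) + \<bar>\<alpha>\<bar> * \<bar>h\<bar>"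
        using b mult_right_mono[OF \<eta>(2), of "\<bar>h\<bar> + \<bar>l\<bar>"] by simp
      finally have "B * \<bar>l\<bar> \<le> 2 * (\<bar>\<alpha>\<bar> + B) * \<bar>h\<bar>"
        using mult_pos_pos[OF B h] mult_nonneg_nonneg[OF abs_ge_zero abs_ge_zero, of \<alpha> h]
        unfolding ring_distribs by linarith
      then have "\<bar>h\<bar> + \<bar>l\<bar> \<le> K * \<bar>h\<bar>" using B by (simp add: K_def field_simps)
      then have "\<eta> * (\<bar>h\<bar> + \<bar>l\<bar>) \<le> \<eta> * K * \<bar>h\<bar>" using \<eta> by (simp add: mult.assoc)
      also have "\<dots> \<le> \<epsilon> * B / 2 * \<bar>h\<bar>" using mult_right_mono[OF \<eta>(3), of "\<bar>h\<bar>"] by simp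
      also have "\<dots> < \<epsilon> * (B * \<bar>h\<bar>)" using \<epsilon> B h by simp
      finally have "\<bar>\<alpha> * h + \<beta> * l\<bar> < \<epsilon> * \<bar>\<beta> * h\<bar>" using b by (simp add: B_def abs_mult)
      moreover have "l / h - - \<alpha> / \<beta> = (\<alpha> * h + \<beta> * l) / (\<beta> * h)"
        using h \<open>\<beta> \<noteq> 0\<close> by (simp add: field_simps)
      ultimately have "\<bar>l / h - - \<alpha> / \<beta>\<bar> < \<epsilon>"
        using h \<open>\<beta> \<noteq> 0\<close> by (simp only: abs_divide) (simp add: field_simps)
      then show "norm ((z y - z e) / (y - e) - - \<alpha> / \<beta>) < \<epsilon>" by (simp add: h_def l_def)
    qed
  qed
  then show ?thesis by (simp add: has_field_derivative_iff)
qed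

lemma DERIV_reflected_diff:
  fixes F :: "real \<Rightarrow> real"
  assumes "(F has_real_derivative p) (at (c + v))" "(F has_real_derivative q) (at (c - v))"
  shows "((\<lambda>v. F (c + v) - F (c - v)) has_real_derivative p - - q) (at v)"
proof (rule DERIV_diff)
  have "((\<lambda>v. c + v) has_real_derivative 1) (at v)" by (auto intro!: derivative_eq_intros)
  then show "((\<lambda>v. F (c + v)) has_real_derivative p) (at v)"
    using DERIV_chain2[of F p "\<lambda>v. c + v" v 1, OF assms(1)] by simp
  have "((\<lambda>v. c - v) has_real_derivative - 1) (at v)" by (auto intro!: derivative_eq_intros)
  then show "((\<lambda>v. F (c - v)) has_real_derivative - q) (at v)"
    using DERIV_chain2[of F q "\<lambda>v. c - v" v "- 1", OF assms(2)] by simp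
qed

text \<open>Integrating by parts, \<open>\<integral> M'' w * (w - c)\<close> over \<open>{e..x}\<close> vanishes; pairing the points
  \<open>c + u\<close> and \<open>c - u\<close> turns this into Rolle's theorem for a function of \<open>u\<close>.\<close>

lemma double_zero_symmetric_pair:
  fixes M M1 M2 :: "real \<Rightarrow> real"
  assumes "e < x"
    and d1: "\<And>w. \<lbrakk>e \<le> w; w \<le> x\<rbrakk> \<Longrightarrow> (M has_real_derivative M1 w) (at w)"
    and d2: "\<And>w. \<lbrakk>e \<le> w; w \<le> x\<rbrakk> \<Longrightarrow> (M1 has_real_derivative M2 w) (at w)"
    and zero: "M e = 0" "M x = 0" "M1 e = 0" "M1 x = 0"
  obtains u where "0 < u" "u < (x - e) / 2" "M2 ((e + x) / 2 + u) = M2 ((e + x) / 2 - u)"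
proof -
  define c L where "c = (e + x) / 2" and "L = (x - e) / 2"
  have ex: "e = c - L" "x = c + L" "L > 0"
    using \<open>e < x\<close> by (simp_all add: c_def L_def field_simps)
  \<comment> \<open>\<open>G\<close> is an antiderivative of \<open>M2 w * (w - c)\<close>, and the
    double zeros make it vanish at \<open>e\<close> and \<open>x\<close>; so \<open>J\<close> takes
    the value 0 at \<open>L\<close> as it does at \<open>0\<close>.\<close>
  define G J where "G w = M1 w * (w - c) - M w" and "J u = G (c + u) - G (c - u)" for w u
  have G: "(G has_real_derivative M2 w * (w - c)) (at w)" if "e \<le> w" "w \<le> x" for w
    unfolding G_def[abs_def] using d1[OF that] d2[OF that] by (auto intro!: derivative_eq_intros)
  have J: "(J has_real_derivative u * (M2 (c + u) - M2 (c - u))) (at u)" if "0 \<le> u" "u \<le> L" for u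
  proof -
    have "(J has_real_derivative M2 (c + u) * (c + u - c) - - (M2 (c - u) * (c - u - c))) (at u)"
      unfolding J_def[abs_def] by (rule DERIV_reflected_diff; rule G) (use that ex in auto)
    then show ?thesis by (simp add: algebra_simps)
  qed
  have "\<exists>u>0. u < L \<and> J L - J 0 = (L - 0) * (u * (M2 (c + u) - M2 (c - u)))"
    by (rule MVT2) (use ex in \<open>auto intro!: J\<close>)
  then obtain u where u: "0 < u" "u < L" "J L - J 0 = (L - 0) * (u * (M2 (c + u) - M2 (c - u)))"
    by blast
  have "G e = 0" "G x = 0" using zero by (simp_all add: G_def)
  then have "J L = 0" "J 0 = 0" using ex(1,2) by (simp_all add: J_def)
  then have "M2 (c + u) = M2 (c - u)" using u ex by simp
  then show ?thesis using that u by (simp add: c_def L_def)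
qed

subsection \<open>Quotients of Bregman divergences\<close>

definition breg :: "(real \<Rightarrow> real) \<Rightarrow> (real \<Rightarrow> real) \<Rightarrow> real \<Rightarrow> real \<Rightarrow> real" where
  "breg f f1 e x = f x - f e - f1 e * (x - e)"

text \<open>Up to sign this is the determinant of the chord and the two tangent vectors at \<open>e\<close> and \<open>x\<close>
  of the space curve \<open>w \<mapsto> (w, g w, f w)\<close>, which explains its symmetry. It is also the numerator of the
  derivative of the quotient of the Bregman divergences.\<close>

definition tangency ::
    "(real \<Rightarrow> real) \<Rightarrow> (real \<Rightarrow> real) \<Rightarrow> (real \<Rightarrow> real) \<Rightarrow> (real \<Rightarrow> real) \<Rightarrow> real \<Rightarrow> real \<Rightarrow> real" where
  "tangency f f1 g g1 e x = (f1 x - f1 e) * breg g g1 e x - (g1 x - g1 e) * breg f f1 e x"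

lemma breg_self [simp]: "breg f f1 e e = 0"
  by (simp add: breg_def)

lemma tangency_commute: "tangency f f1 g g1 e x = tangency f f1 g g1 x e"
  by (simp add: tangency_def breg_def algebra_simps)

text \<open>If the divergence and the slope difference of \<open>f\<close> are both
  \<open>\<beta>\<close> times those of \<open>g\<close>, this identity carries the factor
  \<open>\<beta>\<close> over to the swapped divergences.\<close>

lemma breg_swap: "breg f f1 x e = (f1 x - f1 e) * (x - e) - breg f f1 e x"
  by (simp add: breg_def algebra_simps)

lemma breg_has_real_derivative:
  assumes "(f has_real_derivative f1 x) (at x)"
  shows "(breg f f1 e has_real_derivative f1 x - f1 e) (at x)"
  unfolding breg_def[abs_def] using assms by (auto intro!: derivative_eq_intros)

text \<open>Of entropy and powers, this part retains the convexity of \<open>g\<close> and the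
  single peak \<open>m\<close> of the curvature ratio.\<close>

locale unimodal_curvature_ratio =
  fixes f f1 f2 g g1 g2 :: "real \<Rightarrow> real" and a b m :: real
  assumes m: "a < m" "m < b"
    and f: "\<lbrakk>a < x; x < b\<rbrakk> \<Longrightarrow> (f has_real_derivative f1 x) (at x)"
    and f1: "\<lbrakk>a < x; x < b\<rbrakk> \<Longrightarrow> (f1 has_real_derivative f2 x) (at x)"
    and g: "\<lbrakk>a < x; x < b\<rbrakk> \<Longrightarrow> (g has_real_derivative g1 x) (at x)"
    and g1: "\<lbrakk>a < x; x < b\<rbrakk> \<Longrightarrow> (g1 has_real_derivative g2 x) (at x)"
    and g2_pos: "\<lbrakk>a < x; x < b\<rbrakk> \<Longrightarrow> g2 x > 0"
    and ratio_inc: "\<lbrakk>a < x; x < y; y \<le> m\<rbrakk> \<Longrightarrow> f2 x / g2 x < f2 y / g2 y"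
    and ratio_dec: "\<lbrakk>m \<le> x; x < y; y < b\<rbrakk> \<Longrightarrow> f2 y / g2 y < f2 x / g2 x"
begin

abbreviation r :: "real \<Rightarrow> real" where "r x \<equiv> f2 x / g2 x"
abbreviation N :: "real \<Rightarrow> real \<Rightarrow> real" where "N \<equiv> breg f f1"
abbreviation D :: "real \<Rightarrow> real \<Rightarrow> real" where "D \<equiv> breg g g1"
abbreviation H :: "real \<Rightarrow> real \<Rightarrow> real" where "H \<equiv> tangency f f1 g g1"

text \<open>The derivative of \<open>H\<close> in its second argument; by symmetry of \<open>H\<close>, the derivative in the
  first argument is \<open>H' x e\<close>.\<close>

definition H' :: "real \<Rightarrow> real \<Rightarrow> real" where
  "H' e x = f2 x * D e x - g2 x * N e x"

lemma g1_less:
  assumes "a < x" "x < y" "y < b" shows "g1 x < g1 y"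
proof (rule DERIV_pos_imp_increasing[OF assms(2)])
  fix w assume "x \<le> w" "w \<le> y"
  then show "\<exists>z. (g1 has_real_derivative z) (at w) \<and> z > 0"
    using g1[of w] g2_pos[of w] assms by auto
qed

lemma D_pos:
  assumes "a < e" "e < b" "a < x" "x < b" "x \<noteq> e"
  shows "D e x > 0"
proof (cases "e < x")
  case True
  then obtain z where z: "e < z" "z < x" "g x - g e = (x - e) * g1 z"
    using MVT2[OF True, of g g1] g assms by auto
  then show ?thesis using g1_less[of e z] assms True
    by (simp add: breg_def mult.commute flip: right_diff_distrib)
next
  case False
  then have less: "x < e" using assms by simp
  then obtain z where z: "x < z" "z < e" "g e - g x = (e - x) * g1 z"
    using MVT2[OF less, of g g1] g assms by auto
  then have "D e x = (e - x) * (g1 e - g1 z)" by (simp add: breg_def algebra_simps)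
  then show ?thesis using g1_less[of z e] assms less z by simp
qed

lemma H_has_real_derivative:
  assumes "a < x" "x < b"
  shows "(H e has_real_derivative H' e x) (at x)"
  unfolding tangency_def[abs_def] H'_def
  using breg_has_real_derivative[of f f1, OF f[OF assms], of e]
    breg_has_real_derivative[of g g1, OF g[OF assms], of e]
    f1[OF assms] g1[OF assms]
  by (auto intro!: derivative_eq_intros)

section \<open>Sign changes and zeros of the Wronskian\<close>

text \<open>For \<open>\<beta> = N e x / D e x\<close> the function \<open>w \<mapsto> N e w - \<beta> * D e w\<close> vanishes at \<open>x\<close> and to second order
  at \<open>e\<close>; it vanishes to second order at \<open>x\<close> as well iff \<open>H e x = 0\<close>. The monotonicity of \<open>r\<close>
  controls the sign changes of its second derivative.\<close>

lemma chord_derivatives: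
  assumes "a < w" "w < b"
  shows "((\<lambda>w. N e w - \<beta> * D e w) has_real_derivative f1 w - f1 e - \<beta> * (g1 w - g1 e)) (at w)"
    and "((\<lambda>w. f1 w - f1 e - \<beta> * (g1 w - g1 e)) has_real_derivative g2 w * (r w - \<beta>)) (at w)"
  using breg_has_real_derivative[of f f1, OF f[OF assms], of e]
    breg_has_real_derivative[of g g1, OF g[OF assms], of e]
    f1[OF assms] g1[OF assms] g2_pos[OF assms]
  by (auto intro!: derivative_eq_intros simp: algebra_simps)

text \<open>As \<open>D\<close> is positive off the diagonal, \<open>H e x\<close> has the sign of
  the slope of \<open>N e - \<beta> * D e\<close> at \<open>x\<close>.\<close>

lemma H_eq_chord_slope:
  assumes "D e x \<noteq> 0" "\<beta> = N e x / D e x"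
  shows "H e x = D e x * (f1 x - f1 e - \<beta> * (g1 x - g1 e))"
proof -
  have "N e x = \<beta> * D e x" using assms by simp
  then show ?thesis by (simp add: tangency_def algebra_simps)
qed

text \<open>The chord function and its slope vanish at \<open>e\<close>, and \<open>g2 > 0\<close>
  gives its second derivative the sign of \<open>r - \<beta>\<close>, so
  \<open>slope_neg_if_upcrossing\<close> applies.\<close>

lemma chord_neg:
  assumes "a < e" "e < x" "x < b" "f1 x - f1 e - \<beta> * (g1 x - g1 e) \<le> 0"
    and up: "\<And>u v. \<lbrakk>e < u; u < v; v < x; \<beta> \<le> r u\<rbrakk> \<Longrightarrow> \<beta> < r v"
  shows "N e x - \<beta> * D e x < 0"
proof -
  have "N e x - \<beta> * D e x < N e e - \<beta> * D e e"
  proof (rule slope_neg_if_upcrossing[OF assms(2) chord_derivatives(1) chord_derivatives(2)])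
    fix u v assume uv: "e < u" "u < v" "v < x" "0 \<le> g2 u * (r u - \<beta>)"
    then have "\<beta> \<le> r u" using g2_pos[of u] assms by (simp add: zero_le_mult_iff)
    then show "0 < g2 v * (r v - \<beta>)" using up[OF uv(1-3)] g2_pos[of v] uv assms by simp
  qed (use assms in auto)
  then show ?thesis by simp
qed

lemma chord_pos:
  assumes "a < e" "e < x" "x < b" "f1 x - f1 e - \<beta> * (g1 x - g1 e) \<ge> 0"
    and down: "\<And>u v. \<lbrakk>e < u; u < v; v < x; r u \<le> \<beta>\<rbrakk> \<Longrightarrow> r v < \<beta>"
  shows "N e x - \<beta> * D e x > 0"
proof -
  have "N e x - \<beta> * D e x > N e e - \<beta> * D e e"
  proof (rule slope_pos_if_downcrossing[OF assms(2) chord_derivatives(1) chord_derivatives(2)])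
    fix u v assume uv: "e < u" "u < v" "v < x" "g2 u * (r u - \<beta>) \<le> 0"
    then have "r u \<le> \<beta>" using g2_pos[of u] assms by (simp add: mult_le_0_iff)
    then show "g2 v * (r v - \<beta>) < 0"
      using down[OF uv(1-3)] g2_pos[of v] uv assms by (simp add: mult_pos_neg)
  qed (use assms in auto)
  then show ?thesis by simp
qed

text \<open>Left of \<open>m\<close> the ratio increases, so \<open>r - \<beta>\<close> can cross
  zero only upwards. If \<open>H e x <= 0\<close>, the chord function would be negative at
  \<open>x\<close>, where the choice of \<open>\<beta>\<close> makes it zero.\<close>

lemma H_pos_left:
  assumes "a < e" "e < x" "x \<le> m"
  shows "H e x > 0"
proof (rule ccontr)
  assume neg: "\<not> H e x > 0"
  have D: "D e x > 0" using D_pos[of e x] assms m by simp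
  define \<beta> where "\<beta> = N e x / D e x"
  have "f1 x - f1 e - \<beta> * (g1 x - g1 e) \<le> 0"
    using neg D H_eq_chord_slope[OF _ \<beta>_def] by (auto simp: mult_le_0_iff not_less)
  moreover have "\<beta> < r v" if "e < u" "u < v" "v < x" "\<beta> \<le> r u" for u v
    using ratio_inc[of u v] that assms by linarith
  ultimately have "N e x - \<beta> * D e x < 0" using chord_neg[of e x \<beta>] assms m by simp
  then show False using D by (simp add: \<beta>_def)
qed

lemma H_neg_right:
  assumes "m \<le> e" "e < x" "x < b"
  shows "H e x < 0"
proof (rule ccontr)
  assume neg: "\<not> H e x < 0"
  have D: "D e x > 0" using D_pos[of e x] assms m by simp
  define \<beta> where "\<beta> = N e x / D e x"
  have "f1 x - f1 e - \<beta> * (g1 x - g1 e) \<ge> 0"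
    using neg D H_eq_chord_slope[OF _ \<beta>_def] by (auto simp: zero_le_mult_iff not_less)
  moreover have "r v < \<beta>" if "e < u" "u < v" "v < x" "r u \<le> \<beta>" for u v
    using ratio_dec[of u v] that assms by linarith
  ultimately have "N e x - \<beta> * D e x > 0" using chord_pos[of e x \<beta>] assms m by simp
  then show False using D by (simp add: \<beta>_def)
qed

lemma H_zero_sides:
  assumes "a < e" "e < x" "x < b" "H e x = 0"
  shows "e < m" "m < x"
  using H_pos_left[of e x] H_neg_right[of e x] assms by fastforce+

lemma H_zero_tangent:
  assumes "a < e" "e < x" "x < b" "H e x = 0"
  obtains \<beta> where "N e x = \<beta> * D e x" "f1 x - f1 e = \<beta> * (g1 x - g1 e)"
proof
  have D: "D e x > 0" using D_pos[of e x] assms by simp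
  show 1: "N e x = (N e x / D e x) * D e x" using D by simp
  show "f1 x - f1 e = N e x / D e x * (g1 x - g1 e)"
    using H_eq_chord_slope[OF _ refl, of e x] D assms(4) by simp
qed

text \<open>The partial derivatives are positive multiples of \<open>r x - \<beta>\<close> and
  \<open>r e - \<beta>\<close>, so it suffices that \<open>r\<close> lies below the multiplier
  \<open>\<beta>\<close> at both points.\<close>

lemma H'_neg:
  assumes "a < e" "e < x" "x < b" "H e x = 0"
  shows "H' e x < 0" "H' x e < 0"
proof -
  note sides = H_zero_sides[OF assms]
  have D: "D e x > 0" "D x e > 0" using D_pos[of e x] D_pos[of x e] assms by simp_all
  obtain \<beta> where \<beta>: "N e x = \<beta> * D e x" "f1 x - f1 e = \<beta> * (g1 x - g1 e)"
    using H_zero_tangent[OF assms] by blast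
  \<comment> \<open>If \<open>r e >= \<beta>\<close>, then \<open>r\<close> can drop to
    \<open>\<beta>\<close> only on the falling branch beyond \<open>m\<close>; a single downward
    crossing makes the chord function positive at its zero \<open>x\<close>.\<close>
  have "r e < \<beta>"
  proof (rule ccontr)
    assume ge: "\<not> r e < \<beta>"
    have "r v < \<beta>" if "e < u" "u < v" "v < x" "r u \<le> \<beta>" for u v
    proof -
      have "u > m" using ratio_inc[of e u] that ge assms by fastforce
      then show ?thesis using ratio_dec[of u v] that assms by linarith
    qed
    then have "N e x - \<beta> * D e x > 0" using chord_pos[of e x \<beta>] assms \<beta> by simp
    then show False using \<beta> by simp
  qed
  \<comment> \<open>Mirror case: if \<open>r x >= \<beta>\<close>, the falling branch stays above
    \<open>\<beta>\<close> before \<open>x\<close>, so \<open>r - \<beta>\<close> crosses only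
    upwards.\<close>
  moreover have "r x < \<beta>"
  proof (rule ccontr)
    assume ge: "\<not> r x < \<beta>"
    have "\<beta> < r v" if "e < u" "u < v" "v < x" "\<beta> \<le> r u" for u v
    proof (cases "v \<ge> m")
      case True
      then show ?thesis using ratio_dec[of v x] that ge assms by linarith
    next
      case False
      then show ?thesis using ratio_inc[of u v] that assms by linarith
    qed
    then have "N e x - \<beta> * D e x < 0" using chord_neg[of e x \<beta>] assms \<beta> by simp
    then show False using \<beta> by simp
  qed
  moreover have "N x e = \<beta> * D x e"
    by (simp only: breg_swap[of _ _ x e] \<beta>) (simp add: algebra_simps)
  ultimately have "f2 x * D e x - g2 x * N e x = g2 x * D e x * (r x - \<beta>)" "r x - \<beta> < 0"
    "f2 e * D x e - g2 e * N x e = g2 e * D x e * (r e - \<beta>)" "r e - \<beta> < 0"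
    using \<beta> g2_pos[of e] g2_pos[of x] assms by (simp_all add: field_simps)
  then show "H' e x < 0" "H' x e < 0" unfolding H'_def
    using D g2_pos[of e] g2_pos[of x] assms by (simp_all add: mult_pos_neg)
qed

text \<open>Implicit differentiation moves both arguments at once and calls for the total
  derivative; the product rule yields it from functions of one coordinate each.\<close>

lemma H_has_derivative:
  assumes "a < e" "e < b" "a < x" "x < b"
  shows "((\<lambda>p. H (fst p) (snd p)) has_derivative (\<lambda>h. H' x e * fst h + H' e x * snd h)) (at (e, x))"
proof -
  have fst: "((\<lambda>p. F (fst p)) has_derivative (\<lambda>h. fst h * F')) (at (e, x))"
    if "(F has_real_derivative F') (at e)" for F F'
    by (rule DERIV_compose_FDERIV) (use that in \<open>auto intro: derivative_intros\<close>)
  have snd: "((\<lambda>p. F (snd p)) has_derivative (\<lambda>h. snd h * F')) (at (e, x))"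
    if "(F has_real_derivative F') (at x)" for F F'
    by (rule DERIV_compose_FDERIV) (use that in \<open>auto intro: derivative_intros\<close>)
  show ?thesis
    unfolding tangency_def[abs_def] breg_def[abs_def] H'_def
    by (rule has_derivative_eq_rhs, (rule has_derivative_diff has_derivative_mult
         fst[OF f] fst[OF f1] fst[OF g] fst[OF g1] snd[OF f] snd[OF f1] snd[OF g] snd[OF g1]
         has_derivative_fst has_derivative_snd has_derivative_ident assms)+)
       (auto simp: fun_eq_iff breg_def algebra_simps)
qed

end

section \<open>Stationary points of the Bregman quotient\<close>

context unimodal_curvature_ratio
begin

text \<open>The value \<open>r e\<close> is the limit of the quotient at \<open>e\<close>; for
  entropy and powers this function becomes \<open>psi\<close>.\<close>

definition Q :: "real \<Rightarrow> real \<Rightarrow> real" where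
  "Q e x = (if x = e then r e else N e x / D e x)"

lemma Q_stationary_off_diagonal:
  assumes "a < e" "e < b" "a < x" "x < b" "x \<noteq> e"
  shows "(Q e has_real_derivative 0) (at x) \<longleftrightarrow> H e x = 0"
proof -
  have D: "D e x > 0" using D_pos assms by simp
  have "((\<lambda>x. N e x / D e x) has_real_derivative H e x / (D e x * D e x)) (at x)"
    using breg_has_real_derivative[of f f1, OF f[OF assms(3,4)], of e]
      breg_has_real_derivative[of g g1, OF g[OF assms(3,4)], of e] D
    by (auto intro!: derivative_eq_intros simp: tangency_def mult.commute)
  then have "(Q e has_real_derivative H e x / (D e x * D e x)) (at x)"
    by (rule has_field_derivative_transform_within_open[where S="- {e}"])
       (use assms in \<open>auto simp: Q_def\<close>)
  then show ?thesis using D DERIV_unique by fastforce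
qed

text \<open>\<open>M = N e - r e * D e\<close> is of third order at \<open>e\<close> and
  \<open>D e\<close> of exactly second order. The difference quotient of \<open>Q e\<close> is
  \<open>M x / (D e x * (x - e))\<close> and tends to
  \<open>(g2 e * r' / 6) / (g2 e / 2)\<close>.\<close>

lemma Q_has_real_derivative_diagonal:
  assumes e: "a < e" "e < b" and r': "(r has_real_derivative r') (at e)" and cont: "isCont g2 e"
  shows "(Q e has_real_derivative r' / 3) (at e)"
proof -
  have near: "\<forall>\<^sub>F x in at e. a < x \<and> x < b \<and> x \<noteq> e"
    using eventually_at_in_open[of "{a<..<b}" e] e by simp
  have lim0: "(F \<longlongrightarrow> 0) (at e)" if "(F has_real_derivative F') (at e)" "F e = 0" for F F'
    using DERIV_isCont[OF that(1)] that(2) by (simp add: isCont_def)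
  define M where "M x = N e x - r e * D e x" for x
  define M1 where "M1 x = f1 x - f1 e - r e * (g1 x - g1 e)" for x
  have M: "(M has_real_derivative M1 x) (at x)" "(M1 has_real_derivative g2 x * (r x - r e)) (at x)"
    if "a < x" "x < b" for x
    using chord_derivatives[OF that, of e "r e"] by (simp_all add: M_def[abs_def] M1_def[abs_def])
  \<comment> \<open>The 6 stems from the second derivative of \<open>(x - e) ^ 3\<close>. The limit
    is read off the difference quotient of \<open>r\<close> and the continuity of \<open>g2\<close>
    instead of a third derivative of \<open>M\<close>.\<close>
  have "((\<lambda>x. g2 x * ((r x - r e) / (x - e)) / 6) \<longlongrightarrow> g2 e * r' / 6) (at e)"
    using r' cont by (intro tendsto_intros) (auto simp: has_field_derivative_iff isCont_def)
  then have lim2: "((\<lambda>x. g2 x * (r x - r e) / (6 * (x - e))) \<longlongrightarrow> g2 e * r' / 6) (at e)"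
    by (simp add: mult.commute)
  have lim1: "((\<lambda>x. M1 x / (3 * (x - e)\<^sup>2)) \<longlongrightarrow> g2 e * r' / 6) (at e)"
  proof (rule lhopital[OF _ _ _ _ _ _ lim2])
    show "(M1 \<longlongrightarrow> 0) (at e)" by (rule lim0[OF M(2)[OF e]]) (simp add: M1_def)
    show "((\<lambda>x. 3 * (x - e)\<^sup>2) \<longlongrightarrow> 0) (at e)" by (auto intro!: tendsto_eq_intros)
    show "\<forall>\<^sub>F x in at e. (M1 has_real_derivative g2 x * (r x - r e)) (at x)"
      using near by eventually_elim (use M in blast)
    show "\<forall>\<^sub>F x in at e. ((\<lambda>x. 3 * (x - e)\<^sup>2) has_real_derivative 6 * (x - e)) (at x)"
      by (intro always_eventually allI) (auto intro!: derivative_eq_intros)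
  qed (use near in \<open>auto elim: eventually_mono\<close>)
  have lim_M: "((\<lambda>x. M x / (x - e) ^ 3) \<longlongrightarrow> g2 e * r' / 6) (at e)"
  proof (rule lhopital[OF _ _ _ _ _ _ lim1])
    show "(M \<longlongrightarrow> 0) (at e)" by (rule lim0[OF M(1)[OF e]]) (simp add: M_def)
    show "((\<lambda>x. (x - e) ^ 3) \<longlongrightarrow> 0) (at e)" by (auto intro!: tendsto_eq_intros)
    show "\<forall>\<^sub>F x in at e. (M has_real_derivative M1 x) (at x)"
      using near by eventually_elim (use M in blast)
    show "\<forall>\<^sub>F x in at e. ((\<lambda>x. (x - e) ^ 3) has_real_derivative 3 * (x - e)\<^sup>2) (at x)"
      by (intro always_eventually allI) (auto intro!: derivative_eq_intros)
  qed (use near in \<open>auto elim: eventually_mono\<close>)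
  have "((\<lambda>x. (g1 x - g1 e) / (x - e) / 2) \<longlongrightarrow> g2 e / 2) (at e)"
    using g1[OF e] by (intro tendsto_intros) (auto simp: has_field_derivative_iff)
  then have lim1': "((\<lambda>x. (g1 x - g1 e) / (2 * (x - e))) \<longlongrightarrow> g2 e / 2) (at e)"
    by (simp add: mult.commute)
  have lim_D: "((\<lambda>x. D e x / (x - e)\<^sup>2) \<longlongrightarrow> g2 e / 2) (at e)"
  proof (rule lhopital[OF _ _ _ _ _ _ lim1'])
    have der: "(D e has_real_derivative g1 x - g1 e) (at x)" if "a < x" "x < b" for x
      by (rule breg_has_real_derivative) (rule g[OF that])
    show "(D e \<longlongrightarrow> 0) (at e)" by (rule lim0[OF der[OF e]]) simp
    show "((\<lambda>x. (x - e)\<^sup>2) \<longlongrightarrow> 0) (at e)" by (auto intro!: tendsto_eq_intros)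
    show "\<forall>\<^sub>F x in at e. (D e has_real_derivative g1 x - g1 e) (at x)"
      using near by eventually_elim (use der in blast)
    show "\<forall>\<^sub>F x in at e. ((\<lambda>x. (x - e)\<^sup>2) has_real_derivative 2 * (x - e)) (at x)"
      by (intro always_eventually allI) (auto intro!: derivative_eq_intros)
  qed (use near in \<open>auto elim: eventually_mono\<close>)
  have "((\<lambda>x. (M x / (x - e) ^ 3) / (D e x / (x - e)\<^sup>2)) \<longlongrightarrow> (g2 e * r' / 6) / (g2 e / 2)) (at e)"
    using g2_pos[OF e] by (intro tendsto_divide lim_M lim_D) auto
  also have "(g2 e * r' / 6) / (g2 e / 2) = r' / 3" using g2_pos[OF e] by simp
  finally have "((\<lambda>x. (M x / (x - e) ^ 3) / (D e x / (x - e)\<^sup>2)) \<longlongrightarrow> r' / 3) (at e)" .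
  moreover have "\<forall>\<^sub>F x in at e. (M x / (x - e) ^ 3) / (D e x / (x - e)\<^sup>2) = (Q e x - Q e e) / (x - e)"
    using near
  proof eventually_elim
    case (elim x)
    have alg: "((p - \<rho> * q) / h ^ 3) / (q / h\<^sup>2) = (p / q - \<rho>) / h" if "q \<noteq> 0" "h \<noteq> 0" for p q h \<rho> :: real
      using that by (simp add: field_simps power2_eq_square power3_eq_cube)
    have "D e x \<noteq> 0" "x - e \<noteq> 0" using D_pos[OF e, of x] elim by simp_all
    moreover have "Q e x = N e x / D e x" "Q e e = r e" using elim by (simp_all add: Q_def)
    ultimately show ?case unfolding M_def by (metis alg)
  qed
  ultimately have "((\<lambda>x. (Q e x - Q e e) / (x - e)) \<longlongrightarrow> r' / 3) (at e)"
    by (rule Lim_transform_eventually)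
  then show ?thesis by (simp add: has_field_derivative_iff)
qed

end

subsection \<open>The conjugation\<close>

text \<open>The two conditions supply one sign for the intermediate value theorem; the opposite sign
  is found at \<open>m\<close>, by \<open>H_pos_left\<close> and \<open>H_neg_right\<close>.\<close>

locale unimodal_conjugation = unimodal_curvature_ratio +
  assumes right_neg: "\<lbrakk>a < e; e < m\<rbrakk> \<Longrightarrow> \<exists>x>m. x < b \<and> H e x < 0"
    and left_pos: "\<lbrakk>m < x; x < b\<rbrakk> \<Longrightarrow> \<exists>e>a. e < m \<and> H e x > 0"
begin

section \<open>Existence and location of the zeros of the Wronskian\<close>

lemma H_isCont:
  assumes "a < x" "x < b" shows "isCont (H e) x"
  by (rule DERIV_isCont[OF H_has_real_derivative[OF assms]])

lemma ex_right_root: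
  assumes "a < e" "e < m"
  shows "\<exists>z>m. z < b \<and> H e z = 0"
proof -
  obtain x where x: "m < x" "x < b" "H e x < 0" using right_neg assms by blast
  have m_pos: "H e m > 0" using H_pos_left assms by simp
  have "\<exists>z. m \<le> z \<and> z \<le> x \<and> H e z = 0"
    by (rule IVT2) (use x m_pos m in \<open>auto intro!: H_isCont\<close>)
  then obtain z where "m \<le> z" "z \<le> x" "H e z = 0" by blast
  then show ?thesis using m_pos x by (intro exI[of _ z]) (auto simp: le_less)
qed

lemma ex_left_root:
  assumes "m < x" "x < b"
  shows "\<exists>z>a. z < m \<and> H z x = 0"
proof -
  obtain e where e: "a < e" "e < m" "H x e > 0"
    using left_pos assms tangency_commute by metis
  have m_neg: "H x m < 0" using H_neg_right assms tangency_commute[of f f1 g g1 x m] by simp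
  have "\<exists>z. e \<le> z \<and> z \<le> m \<and> H x z = 0"
    by (rule IVT2) (use e m_neg m in \<open>auto intro!: H_isCont\<close>)
  then obtain z where "e \<le> z" "z \<le> m" "H x z = 0" by blast
  then show ?thesis using m_neg e tangency_commute[of f f1 g g1 x z]
    by (intro exI[of _ z]) (auto simp: le_less)
qed

text \<open>Right of \<open>m\<close> every zero of \<open>H e\<close> has negative slope by
  \<open>H'_neg\<close>, so \<open>z\<close> is the only one and \<open>H e\<close> passes from
  positive to negative there.\<close>

lemma H_sign_right:
  assumes "a < e" "e < m" "m < z" "z < b" "H e z = 0" "m < x" "x < b"
  shows "z < x \<Longrightarrow> H e x < 0" and "x < z \<Longrightarrow> H e x > 0"
proof -
  have der: "(H e has_real_derivative H' e w) (at w)" if "m < w" "w < b" for w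
    using H_has_real_derivative that m by simp
  have neg: "H' e w < 0" if "m < w" "w < b" "H e w = 0" for w
    using H'_neg(1)[of e w] that assms by simp
  show "z < x \<Longrightarrow> H e x < 0"
    by (rule negative_slope_zero_right[where F="H e" and a=m and b=b and F'="H' e", OF der neg])
       (use assms in auto)
  show "x < z \<Longrightarrow> H e x > 0"
    by (rule negative_slope_zero_left[where F="H e" and a=m and b=b and F'="H' e", OF der neg])
       (use assms in auto)
qed

text \<open>The same argument in the first variable, carried out for \<open>H x\<close> by
  symmetry.\<close>

lemma H_neg_beyond_left_root:
  assumes "m < x" "x < b" "a < z" "z < y" "y < m" "H z x = 0"
  shows "H y x < 0"
proof -
  have "H x y < 0"
  proof (rule negative_slope_zero_right[where F="H x" and a=a and b=m and F'="H' x"])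
    show "(H x has_real_derivative H' x w) (at w)" if "a < w" "w < m" for w
      using H_has_real_derivative that m by simp
    show "H' x w < 0" if "a < w" "w < m" "H x w = 0" for w
      using H'_neg(2)[of w x] that assms tangency_commute[of f f1 g g1 w x] by simp
  qed (use assms tangency_commute[of f f1 g g1 z x] in auto)
  then show ?thesis by (simp add: tangency_commute)
qed

section \<open>Conjugate points: uniqueness, involution, monotonicity\<close>

lemma H_zero_opposite:
  assumes "a < e" "e < b" "a < z" "z < b" "z \<noteq> e" "H e z = 0"
  shows "e < m \<and> m < z \<or> z < m \<and> m < e"
proof (cases "e < z")
  case True
  then show ?thesis using H_zero_sides[of e z] assms by simp
next
  case False
  moreover have "H z e = 0" using assms(6) by (simp only: tangency_commute)
  ultimately show ?thesis using H_zero_sides[of z e] assms by simp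
qed

text \<open>\<open>H\<close> vanishes identically on the diagonal, so \<open>z = e\<close> needs its
  own clause: there the derivative of \<open>Q\<close> is a third of the slope of \<open>r\<close>,
  which will vanish only at \<open>m\<close>.\<close>

definition conjugate :: "real \<Rightarrow> real \<Rightarrow> bool" where
  "conjugate e z \<longleftrightarrow> a < z \<and> z < b \<and> (if z = e then e = m else H e z = 0)"

definition Z :: "real \<Rightarrow> real" where
  "Z e = (THE z. conjugate e z)"

lemma conjugate_cases:
  assumes "a < e" "e < b" "conjugate e z"
  obtains "z = m" "e = m" | "e < m" "m < z" "H e z = 0" | "z < m" "m < e" "H e z = 0"
proof (cases "z = e")
  case True
  then show ?thesis using assms(3) that(1) unfolding conjugate_def by simp
next
  case False
  then have "a < z" "z < b" "H e z = 0" using assms(3) unfolding conjugate_def by simp_all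
  then show ?thesis using H_zero_opposite[OF assms(1,2) _ _ False] that(2,3) by blast
qed

text \<open>For \<open>e\<close> different from \<open>m\<close>, all partners lie on the opposite
  side of \<open>m\<close>, where \<open>H\<close> keeps a strict sign beyond the first
  root.\<close>

lemma conjugate_unique:
  assumes "a < e" "e < b" "conjugate e z" "conjugate e w"
  shows "w = z"
proof (rule ccontr)
  assume neq: "w \<noteq> z"
  have *: False if "conjugate e u" "conjugate e v" "u < v" for u v
  proof -
    have u: "a < u" "u < b" and v: "a < v" "v < b"
      using that by (auto simp: conjugate_def)
    show False
    proof (rule conjugate_cases[OF assms(1,2) that(1)])
      assume "u = m" "e = m"
      then show False using conjugate_cases[OF assms(1,2) that(2)] that(3) by fastforce
    next
      assume 2: "e < m" "m < u" "H e u = 0"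
      then have "H e v = 0" using conjugate_cases[OF assms(1,2) that(2)] by fastforce
      moreover have "H e v < 0"
        by (rule H_sign_right(1)[OF assms(1) 2(1,2) u(2) 2(3) _ v(2) that(3)]) (use 2 that in simp)
      ultimately show False by simp
    next
      assume 3: "u < m" "m < e" "H e u = 0"
      then have v': "v < m" "H e v = 0" using conjugate_cases[OF assms(1,2) that(2)] by fastforce+
      have "H v e < 0"
        by (rule H_neg_beyond_left_root[OF 3(2) assms(2) u(1) that(3) v'(1)])
           (use 3(3) in \<open>simp only: tangency_commute\<close>)
      then show False using v'(2) tangency_commute[of f f1 g g1 v e] by simp
    qed
  qed
  show False using *[of w z] *[of z w] assms neq by linarith
qed

lemma ex1_conjugate:
  assumes "a < e" "e < b"
  shows "\<exists>!z. conjugate e z"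
proof (rule ex_ex1I)
  consider "e = m" | "e < m" | "m < e" by linarith
  then show "\<exists>z. conjugate e z"
  proof cases
    case 1
    then show ?thesis using m by (auto simp: conjugate_def)
  next
    case 2
    then obtain z where "m < z" "z < b" "H e z = 0" using ex_right_root[of e] assms by blast
    then show ?thesis using 2 m unfolding conjugate_def by (intro exI[of _ z]) simp
  next
    case 3
    then obtain z where "a < z" "z < m" "H z e = 0" using ex_left_root[of e] assms by blast
    then show ?thesis using 3 m tangency_commute[of f f1 g g1 z e] unfolding conjugate_def
      by (intro exI[of _ z]) simp
  qed
qed (use conjugate_unique assms in blast)

lemma conjugate_Z: "\<lbrakk>a < e; e < b\<rbrakk> \<Longrightarrow> conjugate e (Z e)"
  unfolding Z_def by (rule theI') (rule ex1_conjugate)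

lemma Z_eqI: "\<lbrakk>a < e; e < b; conjugate e z\<rbrakk> \<Longrightarrow> Z e = z"
  using conjugate_unique conjugate_Z by blast

lemma Z_in: "\<lbrakk>a < e; e < b\<rbrakk> \<Longrightarrow> a < Z e \<and> Z e < b"
  using conjugate_Z by (auto simp: conjugate_def)

lemma Z_involution:
  assumes "a < e" "e < b" shows "Z (Z e) = e"
proof (rule Z_eqI)
  show "conjugate (Z e) e"
    using conjugate_Z[OF assms] assms tangency_commute[of f f1 g g1 e "Z e"]
    unfolding conjugate_def by (cases "Z e = e") simp_all
qed (use Z_in[OF assms] in auto)

lemma Z_fixed_iff: "\<lbrakk>a < e; e < b\<rbrakk> \<Longrightarrow> Z e = e \<longleftrightarrow> e = m"
  using conjugate_Z[of e] Z_eqI[of e e] by (auto simp: conjugate_def)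

lemma H_Z:
  assumes "a < e" "e < b" shows "H e (Z e) = 0"
  using conjugate_Z[OF assms] by (cases "Z e = e") (auto simp: conjugate_def tangency_def)

lemma Z_side:
  assumes "a < e" "e < b"
  shows "e < m \<Longrightarrow> m < Z e" and "m < e \<Longrightarrow> Z e < m"
  using conjugate_cases[OF assms conjugate_Z[OF assms]] by fastforce+

lemma Z_strict_antimono:
  assumes "a < x" "x < y" "y < b"
  shows "Z y < Z x"
proof -
  \<comment> \<open>By the shift from \<open>u\<close> to \<open>v\<close>, \<open>H v\<close> is
    negative at \<open>Z u\<close>; but \<open>H v\<close> is positive between \<open>m\<close> and
    its own root \<open>Z v\<close>, so \<open>Z v\<close> comes first.\<close>
  have left: "Z v < Z u" if uv: "a < u" "u < v" "v < m" for u v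
  proof (rule ccontr)
    assume le: "\<not> Z v < Z u"
    have *: "u < b" "a < v" "v < b" using uv m by auto
    have Zu: "m < Z u" "Z u < b" and Zv: "m < Z v" "Z v < b"
      using Z_side[of u] Z_side[of v] Z_in[of u] Z_in[of v] uv m by simp_all
    have "H v (Z u) < 0"
      using H_neg_beyond_left_root[of "Z u" u v] H_Z[of u] Zu uv * by simp
    moreover have "H v (Z u) \<ge> 0"
      using H_sign_right(2)[of v "Z v" "Z u"] H_Z[of v] Zu Zv uv * le by (cases "Z u = Z v") auto
    ultimately show False by simp
  qed
  have in_ab: "x < b" "a < y" using assms by auto
  consider "y < m" | "x < m" "m \<le> y" | "m \<le> x" "m < y" using assms by linarith
  then show ?thesis
  proof cases
    case 1
    then show ?thesis using left assms by simp
  next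
    case 2
    then have "m < Z x" using Z_side assms in_ab by simp
    moreover have "Z y \<le> m" using 2 Z_side(2)[of y] Z_fixed_iff[of y] assms in_ab by force
    ultimately show ?thesis by simp
  next
    case 3
    have Zy: "a < Z y" "Z y < m" and Zx: "a < Z x" "Z x \<le> m" "Z x < b"
      using 3 Z_side(2)[of y] Z_side(2)[of x] Z_fixed_iff[of x] Z_in[of x] Z_in[of y] assms in_ab m
      by force+
    \<comment> \<open>Right of \<open>m\<close> the claim is carried over from the left by the
      involution.\<close>
    show ?thesis
    proof (rule ccontr)
      assume "\<not> Z y < Z x"
      then have "Z x = Z y \<or> Z x < Z y" by linarith
      then have "Z (Z y) \<le> Z (Z x)" using left[of "Z x" "Z y"] Zx Zy by auto
      then show False using Z_involution assms in_ab by simp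
    qed
  qed
qed

section \<open>Continuity and differentiability of the conjugation\<close>

lemma Z_isCont:
  assumes "a < e" "e < b" shows "isCont Z e"
  unfolding isCont_def
proof (rule order_tendstoI)
  \<comment> \<open>Under a decreasing involution the preimage of a ray is again a ray, which yields
    continuity; bounds \<open>v\<close> outside the interval are trivial.\<close>
  have less_swap: "Z u < v" if "Z v < u" "a < u" "u < b" "a < v" "v < b" for u v
    using Z_strict_antimono[of "Z v" u] Z_involution[of v] Z_in[of v] that by simp
  have greater_swap: "v < Z u" if "u < Z v" "a < u" "u < b" "a < v" "v < b" for u v
    using Z_strict_antimono[of u "Z v"] Z_involution[of v] Z_in[of v] that by simp
  have in_ab: "\<forall>\<^sub>F u in at e. a < u \<and> u < b"
    using eventually_at_in_open'[of "{a<..<b}" e] assms by simp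
  fix v
  show "\<forall>\<^sub>F u in at e. v < Z u" if "v < Z e"
  proof (cases "a < v")
    case True
    then have v: "a < v" "v < b" using that Z_in[OF assms] by auto
    then have "e < Z v" using greater_swap less_swap that assms Z_involution
      by (metis Z_strict_antimono Z_in)
    then have "\<forall>\<^sub>F u in at e. u < Z v" using order_tendstoD(2)[OF tendsto_ident_at] by blast
    with in_ab show ?thesis by eventually_elim (use greater_swap v in blast)
  next
    case False
    show ?thesis using in_ab by eventually_elim (use False Z_in in force)
  qed
  show "\<forall>\<^sub>F u in at e. Z u < v" if "Z e < v"
  proof (cases "v < b")
    case True
    then have v: "a < v" "v < b" using that Z_in[OF assms] by auto
    then have "Z v < e" using that assms Z_involution
      by (metis Z_strict_antimono Z_in)
    then have "\<forall>\<^sub>F u in at e. Z v < u" using order_tendstoD(1)[OF tendsto_ident_at] by blast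
    with in_ab show ?thesis by eventually_elim (use less_swap v in blast)
  next
    case False
    show ?thesis using in_ab by eventually_elim (use False Z_in in force)
  qed
qed

text \<open>\<open>H y (Z y)\<close> is zero along the curve, so the linear part of \<open>H\<close>
  at \<open>(e, Z e)\<close> is of smaller order there. Both coefficients are negative by
  \<open>H'_neg\<close>, whence a nonzero quotient.\<close>

lemma Z_deriv_off_diagonal:
  assumes "a < e" "e < b" "e \<noteq> m"
  shows "\<exists>d. d \<noteq> 0 \<and> (Z has_real_derivative d) (at e)"
proof -
  let ?z = "Z e"
  have z: "a < ?z" "?z < b" "?z \<noteq> e" using Z_in Z_fixed_iff assms by auto
  have H': "H' ?z e < 0" "H' e ?z < 0"
    using H'_neg[of e ?z] H'_neg[of ?z e] H_Z[of e] tangency_commute[of f f1 g g1 e ?z] assms z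
    by (cases "e < ?z"; simp)+
  have "(Z has_real_derivative - H' ?z e / H' e ?z) (at e)"
  proof (rule implicit_has_real_derivative[OF Z_isCont])
    fix \<epsilon> :: real assume \<epsilon>: "\<epsilon> > 0"
    obtain d where d: "d > 0" "\<And>p. norm (p - (e, ?z)) < d \<Longrightarrow>
       norm (H (fst p) (snd p) - H e ?z - (H' ?z e * fst (p - (e, ?z)) + H' e ?z * snd (p - (e, ?z))))
       \<le> \<epsilon> * norm (p - (e, ?z))"
      using H_has_derivative[of e ?z] assms z \<epsilon> unfolding has_derivative_at_alt by fastforce
    define \<delta> where "\<delta> = min (d / 2) (min (e - a) (b - e))"
    show "\<exists>\<delta>>0. \<forall>y. \<bar>y - e\<bar> < \<delta> \<and> \<bar>Z y - ?z\<bar> < \<delta> \<longrightarrow>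
       \<bar>H' ?z e * (y - e) + H' e ?z * (Z y - ?z)\<bar> \<le> \<epsilon> * (\<bar>y - e\<bar> + \<bar>Z y - ?z\<bar>)"
    proof (intro exI[of _ \<delta>] conjI allI impI)
      show "\<delta> > 0" using d assms by (simp add: \<delta>_def)
      fix y assume y: "\<bar>y - e\<bar> < \<delta> \<and> \<bar>Z y - ?z\<bar> < \<delta>"
      then have "a < y" "y < b" by (auto simp: \<delta>_def)
      then have "H y (Z y) = 0" by (rule H_Z)
      moreover have le: "norm ((y, Z y) - (e, ?z)) \<le> \<bar>y - e\<bar> + \<bar>Z y - ?z\<bar>"
        using norm_Pair_le[of "y - e" "Z y - ?z"] by simp
      moreover have "norm ((y, Z y) - (e, ?z)) < d" using le y by (simp add: \<delta>_def)
      ultimately have "\<bar>H' ?z e * (y - e) + H' e ?z * (Z y - ?z)\<bar> \<le> \<epsilon> * norm ((y, Z y) - (e, ?z))"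
        using d(2)[of "(y, Z y)"] H_Z[of e] assms by (simp add: abs_minus_commute abs_le_iff)
      also have "\<dots> \<le> \<epsilon> * (\<bar>y - e\<bar> + \<bar>Z y - ?z\<bar>)" using le \<epsilon> by (intro mult_left_mono) auto
      finally show "\<bar>H' ?z e * (y - e) + H' e ?z * (Z y - ?z)\<bar> \<le> \<dots>" .
    qed
  qed (use assms H' in auto)
  then show ?thesis using H' by (intro exI conjI) auto
qed

text \<open>Let \<open>L = x - e\<close> and let \<open>d\<close> be the offset of the midpoint
  \<open>c\<close> from \<open>m\<close>. Some values \<open>M2 (c + u)\<close> and
  \<open>M2 (c - u)\<close> agree. As \<open>g2\<close> is Lipschitz and \<open>r - \<beta>\<close>
  is of order \<open>L^2\<close>, the values of \<open>r\<close> there differ by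
  \<open>O(L^2 * u)\<close>, whereas the formula for the slope of \<open>r\<close> makes the
  difference about \<open>- 2 * s m * d * u\<close>.\<close>

lemma chord_midpoint_bound:
  assumes lip: "\<And>u v. \<lbrakk>a < u; u < b; a < v; v < b\<rbrakk> \<Longrightarrow> \<bar>g2 u - g2 v\<bar> \<le> K * \<bar>u - v\<bar>"
    and r': "\<And>w. \<lbrakk>a < w; w < b\<rbrakk> \<Longrightarrow> (r has_real_derivative - (w - m) * s w) (at w)"
    and s: "isCont s m" "s m > 0"
    and "\<epsilon> > 0"
  shows "\<exists>\<delta>>0. \<forall>e x. a < e \<and> e < x \<and> x < b \<and> x - e < \<delta> \<and> H e x = 0 \<longrightarrow>
    \<bar>e + x - 2 * m\<bar> \<le> \<epsilon> * (x - e)"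
proof -
  \<comment> \<open>\<open>\<eta> <= s0 / 2\<close> bounds \<open>s\<close> by
    \<open>3 / 2 * s0\<close>; the other bound keeps each of the last two error terms below
    \<open>\<epsilon> * s0 / 4 * L\<close>.\<close>
  define s0 g0 K' \<eta> where "s0 = s m" and "g0 = g2 m" and "K' = \<bar>K\<bar> + 1"
    and "\<eta> = min (s0 / 2) (\<epsilon> * s0 / 4)"
  have pos: "s0 > 0" "g0 > 0" "K' > 0" "\<eta> > 0" "\<eta> \<le> s0 / 2" "\<eta> \<le> \<epsilon> * s0 / 4"
    using s g2_pos m \<open>\<epsilon> > 0\<close> by (auto simp: s0_def g0_def K'_def \<eta>_def)
  have lip': "\<bar>g2 u - g2 v\<bar> \<le> K' * \<bar>u - v\<bar>" if "a < u" "u < b" "a < v" "v < b" for u v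
    using lip[OF that] mult_right_mono[of K K' "\<bar>u - v\<bar>"] unfolding K'_def by linarith
  obtain \<delta>0 where \<delta>0: "\<delta>0 > 0" "\<And>w. \<bar>w - m\<bar> < \<delta>0 \<Longrightarrow> \<bar>s w - s0\<bar> < \<eta>"
    using s(1) pos(4) by (auto simp: continuous_at_eps_delta dist_real_def s0_def)
  \<comment> \<open>The second entry keeps \<open>g2\<close> above \<open>g0 / 2\<close>; the third
    turns the quadratic estimate for \<open>R' v\<close> into one linear in
    \<open>L\<close>.\<close>
  define \<delta> where "\<delta> = Min {\<delta>0, g0 / (2 * K'), \<epsilon> * g0 / (12 * K')}"
  have \<delta>: "\<delta> > 0" "\<delta> \<le> \<delta>0" "\<delta> \<le> g0 / (2 * K')" "\<delta> \<le> \<epsilon> * g0 / (12 * K')"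
    using pos \<open>\<epsilon> > 0\<close> \<delta>0 by (simp_all add: \<delta>_def)
  show ?thesis
  proof (intro exI[of _ \<delta>] conjI allI impI)
    fix e x assume "a < e \<and> e < x \<and> x < b \<and> x - e < \<delta> \<and> H e x = 0"
    then have ex: "a < e" "e < x" "x < b" "x - e < \<delta>" "H e x = 0" by auto
    note sides = H_zero_sides[OF ex(1-3,5)]
    define L c d where "L = x - e" and "c = (e + x) / 2" and "d = c - m"
    have L: "0 < L" "L < \<delta>" "e = c - L / 2" "x = c + L / 2"
      using ex by (auto simp: L_def c_def field_simps)
    obtain \<beta> where \<beta>: "N e x = \<beta> * D e x" "f1 x - f1 e = \<beta> * (g1 x - g1 e)"
      using H_zero_tangent[OF ex(1-3,5)] by blast
    define M M1 M2 where "M w = N e w - \<beta> * D e w" and "M1 w = f1 w - f1 e - \<beta> * (g1 w - g1 e)"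
      and "M2 w = g2 w * (r w - \<beta>)" for w
    have M: "(M has_real_derivative M1 w) (at w)" "(M1 has_real_derivative M2 w) (at w)"
      if "a < w" "w < b" for w
      using chord_derivatives[OF that, of e \<beta>] by (simp_all add: M_def[abs_def] M1_def[abs_def] M2_def)
    have M0: "M e = 0" "M x = 0" "M1 e = 0" "M1 x = 0" using \<beta> by (simp_all add: M_def M1_def)
    have inI: "a < w" "w < b" "\<bar>w - m\<bar> \<le> L" "\<bar>s w - s0\<bar> \<le> \<eta>" if w: "e \<le> w" "w \<le> x" for w
    proof -
      show "a < w" "w < b" using w ex by simp_all
      show *: "\<bar>w - m\<bar> \<le> L" using w sides unfolding abs_le_iff L_def by simp
      have "\<bar>w - m\<bar> < \<delta>0" using * L(2) \<delta>(2) by linarith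
      then show "\<bar>s w - s0\<bar> \<le> \<eta>" using \<delta>0(2) by (simp add: less_imp_le)
    qed
    \<comment> \<open>\<open>M1\<close> vanishes at both ends, so \<open>\<beta>\<close> is a value
      of \<open>r\<close> between \<open>e\<close> and \<open>x\<close>.\<close>
    have "\<exists>\<xi>>e. \<xi> < x \<and> M1 x - M1 e = (x - e) * M2 \<xi>"
      by (rule MVT2) (use ex in \<open>auto intro!: M(2)\<close>)
    then obtain \<xi> where \<xi>: "e < \<xi>" "\<xi> < x" "M1 x - M1 e = (x - e) * M2 \<xi>" by blast
    have \<beta>_eq: "\<beta> = r \<xi>" using \<xi> M0 ex g2_pos[of \<xi>] by (simp add: M2_def)
    \<comment> \<open>Within distance \<open>L\<close> of the peak the slope of \<open>r\<close> is
      itself of order \<open>L\<close>, hence the square.\<close>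
    have r_bound: "\<bar>r w - \<beta>\<bar> \<le> 3 / 2 * s0 * L\<^sup>2" if w: "e \<le> w" "w \<le> x" for w
    proof -
      have "\<bar>r w - r \<xi>\<bar> \<le> (3 / 2 * s0 * L) * \<bar>w - \<xi>\<bar>"
      proof (rule field_differentiable_bound[of "{e..x}" r, unfolded real_norm_def])
        fix y assume "y \<in> {e..x}"
        then have y: "e \<le> y" "y \<le> x" by auto
        show "(r has_real_derivative - (y - m) * s y) (at y within {e..x})"
          by (rule has_field_derivative_at_within[OF r'[OF inI(1,2)[OF y]]])
        have "\<bar>s y\<bar> \<le> 3 / 2 * s0" using inI(4)[OF y] pos(5) unfolding abs_le_iff by linarith
        then have "\<bar>y - m\<bar> * \<bar>s y\<bar> \<le> L * (3 / 2 * s0)"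
          using inI(3)[OF y] L(1) by (intro mult_mono) simp_all
        then show "\<bar>- (y - m) * s y\<bar> \<le> 3 / 2 * s0 * L"
          by (simp add: abs_mult mult_ac abs_minus_commute[of m y])
      qed (use w \<xi> in auto)
      also have "\<dots> \<le> (3 / 2 * s0 * L) * L"
        using w \<xi> pos L(1) by (intro mult_left_mono) (auto simp: L_def)
      finally show ?thesis by (simp add: \<beta>_eq power2_eq_square)
    qed
    obtain u where u: "0 < u" "u < L / 2" and M2_eq: "M2 (c + u) = M2 (c - u)"
    proof (rule double_zero_symmetric_pair[OF ex(2), of M M1 M2])
      show "(M has_real_derivative M1 w) (at w)" "(M1 has_real_derivative M2 w) (at w)"
        if "e \<le> w" "w \<le> x" for w
        using M inI[OF that] by blast+
    qed (use M0 that in \<open>simp_all add: L_def c_def\<close>)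
    have cu: "e \<le> c + u" "c + u \<le> x" "e \<le> c - u" "c - u \<le> x" using u L by auto
    \<comment> \<open>The equality of products is rearranged so that the difference of
      \<open>r\<close> is paid for by the variation of \<open>g2\<close>.\<close>
    have "p * (y - z) = (q - p) * (z - \<beta>)" if "p * (y - \<beta>) = q * (z - \<beta>)" for p q y z :: real
      using that by (simp add: algebra_simps)
    from this[OF M2_eq[unfolded M2_def]]
    have "g2 (c + u) * (r (c + u) - r (c - u)) = (g2 (c - u) - g2 (c + u)) * (r (c - u) - \<beta>)" .
    then have "g2 (c + u) * \<bar>r (c + u) - r (c - u)\<bar> = \<bar>g2 (c - u) - g2 (c + u)\<bar> * \<bar>r (c - u) - \<beta>\<bar>"
      using g2_pos[of "c + u"] inI[OF cu(1,2)] by (metis abs_mult abs_of_pos)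
    also have "\<dots> \<le> (K' * (2 * u)) * (3 / 2 * s0 * L\<^sup>2)"
      using lip'[of "c - u" "c + u"] inI[OF cu(1,2)] inI[OF cu(3,4)] r_bound[OF cu(3,4)] u pos
      by (intro mult_mono) auto
    finally have 1: "g2 (c + u) * \<bar>r (c + u) - r (c - u)\<bar> \<le> 3 * K' * s0 * L\<^sup>2 * u" by (simp add: mult_ac)
    have "\<bar>g2 (c + u) - g0\<bar> \<le> K' * \<bar>c + u - m\<bar>"
      using lip'[of "c + u" m] inI[OF cu(1,2)] m by (simp add: g0_def)
    also have "\<dots> \<le> K' * \<delta>" using inI[OF cu(1,2)] pos L by (intro mult_left_mono) auto
    also have "\<dots> \<le> g0 / 2" using \<delta>(3) pos by (simp add: field_simps)
    finally have "g0 / 2 \<le> g2 (c + u)" by linarith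
    then have 2: "g0 / 2 * \<bar>r (c + u) - r (c - u)\<bar> \<le> 3 * K' * s0 * L\<^sup>2 * u"
      using 1 mult_right_mono[of "g0 / 2" "g2 (c + u)" "\<bar>r (c + u) - r (c - u)\<bar>"] by linarith
    define R where "R v = r (c + v) - r (c - v)" for v
    \<comment> \<open>To leading order the terms in \<open>v\<close> cancel and
      \<open>- 2 * s0 * d\<close> remains.\<close>
    define R' where "R' v = - (d + v) * s (c + v) - (d - v) * s (c - v)" for v
    have R: "(R has_real_derivative R' v) (at v)" if "0 \<le> v" "v \<le> u" for v
    proof -
      have in1: "a < c + v" "c + v < b" "a < c - v" "c - v < b" using that u L ex by auto
      have "(R has_real_derivative - (c + v - m) * s (c + v) - - (- (c - v - m) * s (c - v))) (at v)"
        unfolding R_def[abs_def] by (rule DERIV_reflected_diff) (rule r' in1)+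
      then show ?thesis by (simp add: R'_def d_def algebra_simps)
    qed
    have "\<exists>v>0. v < u \<and> R u - R 0 = (u - 0) * R' v"
      by (rule MVT2) (use u in \<open>auto intro!: R\<close>)
    then obtain v where v: "0 < v" "v < u" "R u - R 0 = (u - 0) * R' v" by blast
    then have "\<bar>r (c + u) - r (c - u)\<bar> = u * \<bar>R' v\<bar>"
      using u by (simp add: R_def abs_mult)
    then have "(g0 / 2 * \<bar>R' v\<bar>) * u \<le> (3 * K' * s0 * L\<^sup>2) * u" using 2 by (simp add: mult_ac)
    then have "g0 / 2 * \<bar>R' v\<bar> \<le> 3 * K' * s0 * L\<^sup>2" using u(1) by (rule mult_right_le_imp_le)
    also have "\<dots> = (3 * K' * s0 * L) * L" by (simp add: power2_eq_square)
    also have "\<dots> \<le> (3 * K' * s0 * (\<epsilon> * g0 / (12 * K'))) * L"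
      using L \<delta>(4) pos by (intro mult_right_mono mult_left_mono) auto
    finally have R'_bound: "\<bar>R' v\<bar> \<le> \<epsilon> * s0 / 2 * L" using pos by (simp add: field_simps)
    have cv: "e \<le> c + v" "c + v \<le> x" "e \<le> c - v" "c - v \<le> x" using u v L by auto
    have dv: "\<bar>d + v\<bar> \<le> L" "\<bar>d - v\<bar> \<le> L"
      using inI(3)[OF cv(1,2)] inI(3)[OF cv(3,4)] by (simp_all add: d_def algebra_simps)
    have sv: "\<bar>s (c + v) - s0\<bar> \<le> \<epsilon> * s0 / 4" "\<bar>s (c - v) - s0\<bar> \<le> \<epsilon> * s0 / 4"
      using inI(4)[OF cv(1,2)] inI(4)[OF cv(3,4)] pos(6) by linarith+
    have "\<bar>(d + v) * (s (c + v) - s0)\<bar> \<le> L * (\<epsilon> * s0 / 4)"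
      unfolding abs_mult by (rule mult_mono[OF dv(1) sv(1)]) (use L in simp_all)
    moreover have "\<bar>(d - v) * (s (c - v) - s0)\<bar> \<le> L * (\<epsilon> * s0 / 4)"
      unfolding abs_mult by (rule mult_mono[OF dv(2) sv(2)]) (use L in simp_all)
    moreover have "2 * s0 * d = - R' v - (d + v) * (s (c + v) - s0) - (d - v) * (s (c - v) - s0)"
      by (simp add: R'_def algebra_simps)
    ultimately have "\<bar>2 * s0 * d\<bar> \<le> \<epsilon> * s0 / 2 * L + L * (\<epsilon> * s0 / 4) + L * (\<epsilon> * s0 / 4)"
      using R'_bound by linarith
    then have "s0 * (2 * \<bar>d\<bar>) \<le> s0 * (\<epsilon> * L)" using pos by (simp add: abs_mult algebra_simps)
    then have "2 * \<bar>d\<bar> \<le> \<epsilon> * L" using pos by simp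
    moreover have "e + x - 2 * m = 2 * d" by (simp add: d_def c_def)
    ultimately show "\<bar>e + x - 2 * m\<bar> \<le> \<epsilon> * (x - e)" by (simp add: L_def abs_mult)
  qed (rule \<delta>)
qed

text \<open>Both partial derivatives of \<open>H\<close> vanish at \<open>(m, m)\<close>. The
  midpoint bound supplies the linear relation instead, with both coefficients equal to 1.\<close>

lemma Z_deriv_fixed_point:
  assumes lip: "\<And>u v. \<lbrakk>a < u; u < b; a < v; v < b\<rbrakk> \<Longrightarrow> \<bar>g2 u - g2 v\<bar> \<le> K * \<bar>u - v\<bar>"
    and r': "\<And>w. \<lbrakk>a < w; w < b\<rbrakk> \<Longrightarrow> (r has_real_derivative - (w - m) * s w) (at w)"
    and s: "isCont s m" "s m > 0"
  shows "(Z has_real_derivative - 1) (at m)"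
proof -
  have Zm: "Z m = m" using Z_fixed_iff m by simp
  have "(Z has_real_derivative - 1 / 1) (at m)"
  proof (rule implicit_has_real_derivative[OF Z_isCont])
    fix \<epsilon> :: real assume \<epsilon>: "\<epsilon> > 0"
    obtain \<delta>0 where \<delta>0: "\<delta>0 > 0" "\<And>e x. \<lbrakk>a < e; e < x; x < b; x - e < \<delta>0; H e x = 0\<rbrakk> \<Longrightarrow>
        \<bar>e + x - 2 * m\<bar> \<le> \<epsilon> * (x - e)"
      using chord_midpoint_bound[OF lip r' s \<epsilon>] by blast
    define \<delta> where "\<delta> = min (\<delta>0 / 2) (min (m - a) (b - m))"
    show "\<exists>\<delta>>0. \<forall>y. \<bar>y - m\<bar> < \<delta> \<and> \<bar>Z y - Z m\<bar> < \<delta> \<longrightarrow>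
       \<bar>1 * (y - m) + 1 * (Z y - Z m)\<bar> \<le> \<epsilon> * (\<bar>y - m\<bar> + \<bar>Z y - Z m\<bar>)"
    proof (intro exI[of _ \<delta>] conjI allI impI)
      show "\<delta> > 0" using \<delta>0 m by (simp add: \<delta>_def)
      fix y assume "\<bar>y - m\<bar> < \<delta> \<and> \<bar>Z y - Z m\<bar> < \<delta>"
      then have y: "\<bar>y - m\<bar> < \<delta>0 / 2" "\<bar>Z y - m\<bar> < \<delta>0 / 2" "a < y" "y < b"
        by (auto simp: \<delta>_def Zm)
      note Zy = Z_in[OF y(3,4)] H_Z[OF y(3,4)]
      consider "y = m" | "y < m" | "m < y" by linarith
      then have "\<bar>y + Z y - 2 * m\<bar> \<le> \<epsilon> * (\<bar>y - m\<bar> + \<bar>Z y - m\<bar>)"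
      proof cases
        case 1
        then show ?thesis by (simp add: Zm)
      next
        case 2
        then have "m < Z y" using Z_side y by simp
        then show ?thesis using 2 \<delta>0(2)[of y "Z y"] y Zy by (simp add: abs_if)
      next
        case 3
        then have "Z y < m" using Z_side y by simp
        then show ?thesis using 3 \<delta>0(2)[of "Z y" y] y Zy tangency_commute[of f f1 g g1 y "Z y"]
          by (simp add: abs_if add.commute)
      qed
      then show "\<bar>1 * (y - m) + 1 * (Z y - Z m)\<bar> \<le> \<epsilon> * (\<bar>y - m\<bar> + \<bar>Z y - Z m\<bar>)"
        by (simp add: Zm algebra_simps)
    qed
  qed (use m in auto)
  then show ?thesis by simp
qed

end

subsection \<open>Entropy and powers\<close>

text \<open>With \<open>k = n + 2\<close> the exponents of the power and its derivatives involve no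
  truncated subtraction.\<close>

context
  fixes n :: nat
begin

definition peak :: real where "peak = (real n + 1) / (real n + 2)"
text \<open>The factor 2 in the numerator of \<open>psi\<close> is absorbed here.\<close>

definition ent :: "real \<Rightarrow> real" where "ent w = 2 * S0 w"
definition ent1 :: "real \<Rightarrow> real" where "ent1 w = ln (1 - w) - ln w"
definition ent2 :: "real \<Rightarrow> real" where "ent2 w = - 1 / (w * (1 - w))"
definition pow :: "real \<Rightarrow> real" where "pow w = w ^ (n + 2)"
definition pow1 :: "real \<Rightarrow> real" where "pow1 w = (real n + 2) * w ^ (n + 1)"
definition pow2 :: "real \<Rightarrow> real" where "pow2 w = (real n + 2) * (real n + 1) * w ^ n"

lemma peak: "0 < peak" "peak < 1"
  by (simp_all add: peak_def)

lemma ent: "\<lbrakk>0 < w; w < 1\<rbrakk> \<Longrightarrow> (ent has_real_derivative ent1 w) (at w)"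
proof -
  assume w: "0 < w" "w < 1"
  have "((\<lambda>w. w * ln w) has_real_derivative ln w + 1) (at w)"
    using w by (auto intro!: derivative_eq_intros)
  moreover have "((\<lambda>w. (1 - w) * ln (1 - w)) has_real_derivative - ln (1 - w) - 1) (at w)"
    using w by (auto intro!: derivative_eq_intros)
  ultimately have "((\<lambda>w. - (w * ln w + (1 - w) * ln (1 - w))) has_real_derivative
      - (ln w + 1 + (- ln (1 - w) - 1))) (at w)"
    by (intro DERIV_minus DERIV_add)
  moreover have "ent = (\<lambda>w. - (w * ln w + (1 - w) * ln (1 - w)))"
    by (simp add: fun_eq_iff ent_def S0_def field_simps)
  ultimately show ?thesis by (simp add: ent1_def)
qed

lemma ent1: "\<lbrakk>0 < w; w < 1\<rbrakk> \<Longrightarrow> (ent1 has_real_derivative ent2 w) (at w)"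
  unfolding ent1_def[abs_def] ent2_def
  by (auto intro!: derivative_eq_intros simp: field_simps)

lemma pow: "(pow has_real_derivative pow1 w) (at w)"
  using DERIV_pow[of "n + 2" w] by (simp add: pow_def[abs_def] pow1_def add.commute)

lemma pow1: "(pow1 has_real_derivative pow2 w) (at w)"
  using DERIV_cmult[OF DERIV_pow[of "n + 1" w], of "real n + 2"]
  by (simp add: pow1_def[abs_def] pow2_def mult.assoc add.commute)

lemma pow2_pos: "0 < w \<Longrightarrow> pow2 w > 0"
  by (simp add: pow2_def add_pos_nonneg)

lemma pow2_lipschitz:
  assumes "0 < u" "u < 1" "0 < v" "v < 1"
  shows "\<bar>pow2 u - pow2 v\<bar> \<le> ((real n + 2) * (real n + 1) * n) * \<bar>u - v\<bar>"
proof -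
  have "\<bar>u ^ n - v ^ n\<bar> \<le> n * \<bar>u - v\<bar>" using norm_power_diff[of u v n] assms by simp
  then have "(real n + 2) * (real n + 1) * \<bar>u ^ n - v ^ n\<bar> \<le> (real n + 2) * (real n + 1) * (n * \<bar>u - v\<bar>)"
    by (intro mult_left_mono) auto
  moreover have "pow2 u - pow2 v = (real n + 2) * (real n + 1) * (u ^ n - v ^ n)"
    by (simp add: pow2_def right_diff_distrib)
  ultimately show ?thesis by (simp add: abs_mult mult.assoc)
qed

text \<open>The positive cofactor left after splitting \<open>peak - w\<close> off the derivative of
  the curvature ratio.\<close>

definition slope :: "real \<Rightarrow> real" where
  "slope w = 1 / ((real n + 1) * w ^ (n + 2) * (1 - w)\<^sup>2)"

lemma slope_pos: "\<lbrakk>0 < w; w < 1\<rbrakk> \<Longrightarrow> slope w > 0"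
  by (simp add: slope_def add_pos_nonneg)

lemma isCont_slope: "\<lbrakk>0 < w; w < 1\<rbrakk> \<Longrightarrow> isCont slope w"
  unfolding slope_def[abs_def] by (intro continuous_intros) auto

text \<open>The ratio is a negative multiple of the reciprocal of
  \<open>w ^ (n + 1) * (1 - w)\<close>, whose critical point in the interval is
  \<open>peak\<close>.\<close>

lemma ratio_deriv:
  assumes "0 < w" "w < 1"
  shows "((\<lambda>w. ent2 w / pow2 w) has_real_derivative - (w - peak) * slope w) (at w)"
proof -
  define c where "c = (real n + 2) * (real n + 1)"
  have c: "c \<noteq> 0" unfolding c_def by (simp add: add_nonneg_eq_0_iff)
  have nz: "c * (w ^ (n + 1) * (1 - w)) \<noteq> 0" using c assms by simp
  have "((\<lambda>w. - 1 / (c * (w ^ (n + 1) * (1 - w)))) has_real_derivative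
      (c * ((real n + 1) * w ^ n * (1 - w) - w ^ (n + 1))) / (c * (w ^ (n + 1) * (1 - w)))\<^sup>2) (at w)"
  proof -
    have "((\<lambda>w. w ^ (n + 1) * (1 - w)) has_real_derivative
        (real n + 1) * w ^ n * (1 - w) - w ^ (n + 1)) (at w)"
      using DERIV_mult[OF DERIV_pow[of "n + 1" w] DERIV_diff[OF DERIV_const[of 1] DERIV_ident]]
      by (simp add: algebra_simps)
    note DERIV_divide[of "\<lambda>_. - 1" 0 w UNIV, OF DERIV_const DERIV_cmult[OF this, of c] nz]
    then show ?thesis by (rule DERIV_cong) (simp add: power2_eq_square)
  qed
  moreover have "(c * ((real n + 1) * w ^ n * (1 - w) - w ^ (n + 1))) / (c * (w ^ (n + 1) * (1 - w)))\<^sup>2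
      = - (w - peak) * slope w"
  proof -
    have "(real n + 1) * w ^ n * (1 - w) - w ^ (n + 1) = - ((real n + 2) * (w - peak)) * w ^ n"
      by (simp add: peak_def field_simps add_nonneg_eq_0_iff)
    moreover have "(c * (w ^ (n + 1) * (1 - w)))\<^sup>2 = c\<^sup>2 * (w ^ n * w ^ (n + 2)) * (1 - w)\<^sup>2"
      by (simp add: power_mult_distrib power2_eq_square)
    moreover have "real n + 2 \<noteq> 0" "real n + 1 \<noteq> 0" by (simp_all add: add_nonneg_eq_0_iff)
    ultimately show ?thesis using assms c unfolding slope_def
      by (simp add: c_def power2_eq_square divide_simps)
  qed
  ultimately have "((\<lambda>w. - 1 / (c * (w ^ (n + 1) * (1 - w)))) has_real_derivative
      - (w - peak) * slope w) (at w)" by simp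
  then show ?thesis
    by (rule has_field_derivative_transform_within_open[where S="{0<..<1}"])
       (use assms in \<open>auto simp: ent2_def pow2_def c_def mult_ac\<close>)
qed

lemma ratio_inc:
  assumes "0 < x" "x < y" "y \<le> peak"
  shows "ent2 x / pow2 x < ent2 y / pow2 y"
proof (rule DERIV_pos_imp_increasing_open[OF assms(2)])
  fix w assume "x < w" "w < y"
  then have "0 < w" "w < 1" "- (w - peak) * slope w > 0"
    using slope_pos[of w] assms peak by (simp_all add: mult_neg_pos)
  then show "\<exists>d. ((\<lambda>w. ent2 w / pow2 w) has_real_derivative d) (at w) \<and> d > 0"
    using ratio_deriv by blast
next
  show "continuous_on {x..y} (\<lambda>w. ent2 w / pow2 w)"
    by (intro continuous_at_imp_continuous_on ballI DERIV_isCont[OF ratio_deriv])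
       (use assms peak in auto)
qed

lemma ratio_dec:
  assumes "peak \<le> x" "x < y" "y < 1"
  shows "ent2 y / pow2 y < ent2 x / pow2 x"
proof (rule DERIV_neg_imp_decreasing_open[OF assms(2)])
  fix w assume "x < w" "w < y"
  then have "0 < w" "w < 1" "- (w - peak) * slope w < 0"
    using slope_pos[of w] assms peak by (simp_all add: mult_neg_pos)
  then show "\<exists>d. ((\<lambda>w. ent2 w / pow2 w) has_real_derivative d) (at w) \<and> d < 0"
    using ratio_deriv by blast
next
  show "continuous_on {x..y} (\<lambda>w. ent2 w / pow2 w)"
    by (intro continuous_at_imp_continuous_on ballI DERIV_isCont[OF ratio_deriv])
       (use assms peak in auto)
qed

section \<open>Boundary behaviour of the Wronskian\<close>

lemma breg_pow_pos:
  assumes "0 < e" "e < 1"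
  shows "breg pow pow1 e 1 > 0" "breg pow pow1 e 0 > 0"
proof -
  obtain z where z: "e < z" "pow 1 - pow e = (1 - e) * pow1 z"
    using MVT2[of e 1 pow pow1] pow assms by auto
  have "pow1 e < pow1 z"
    unfolding pow1_def using z(1) assms
    by (intro mult_strict_left_mono power_strict_mono) (auto simp: add_pos_nonneg)
  then have "(1 - e) * (pow1 z - pow1 e) > 0" using assms by simp
  then show "breg pow pow1 e 1 > 0" using z(2) by (simp add: breg_def algebra_simps)
  have "breg pow pow1 e 0 = (real n + 1) * e ^ (n + 2)"
    by (simp add: breg_def pow_def pow1_def algebra_simps)
  then show "breg pow pow1 e 0 > 0" using assms by (simp add: add_pos_nonneg)
qed

text \<open>\<open>ent1\<close> tends to minus infinity and is multiplied by a divergence with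
  positive limit, by \<open>breg_pow_pos\<close>. The other product stays bounded, since
  \<open>ent\<close> tends to 0.\<close>

lemma tangency_at_1:
  assumes "0 < e" "e < 1"
  shows "filterlim (tangency ent ent1 pow pow1 e) at_bot (at_left 1)"
proof -
  have "filterlim (\<lambda>x. - ent1 e + ent1 x) at_bot (at_left 1)"
    unfolding ent1_def by (rule filterlim_tendsto_add_at_bot_iff[OF tendsto_const, THEN iffD2]) real_asymp
  moreover have "(breg pow pow1 e \<longlongrightarrow> breg pow pow1 e 1) (at_left 1)"
    unfolding breg_def[abs_def] pow_def by (intro tendsto_intros)
  ultimately have "filterlim (\<lambda>x. breg pow pow1 e x * (- ent1 e + ent1 x)) at_bot (at_left 1)"
    using breg_pow_pos(1)[OF assms] by (intro filterlim_tendsto_pos_mult_at_bot)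
  moreover have ent_lim: "(ent \<longlongrightarrow> 0) (at_left 1)"
    unfolding ent_def[abs_def] S0_def by real_asymp
  have "((\<lambda>x. - ((pow1 x - pow1 e) * breg ent ent1 e x)) \<longlongrightarrow>
      - ((pow1 1 - pow1 e) * (0 - ent e - ent1 e * (1 - e)))) (at_left 1)"
    unfolding breg_def[abs_def] pow1_def by (intro tendsto_intros ent_lim)
  ultimately have "filterlim (\<lambda>x. - ((pow1 x - pow1 e) * breg ent ent1 e x)
      + breg pow pow1 e x * (- ent1 e + ent1 x)) at_bot (at_left 1)"
    by (subst filterlim_tendsto_add_at_bot_iff)
  then show ?thesis by (simp add: tangency_def[abs_def] algebra_simps)
qed

lemma tangency_at_0:
  assumes "0 < e" "e < 1"
  shows "filterlim (tangency ent ent1 pow pow1 e) at_top (at_right 0)"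
proof -
  have "filterlim (\<lambda>x. - ent1 e + ent1 x) at_top (at_right 0)"
    unfolding ent1_def by (rule filterlim_tendsto_add_at_top[OF tendsto_const]) real_asymp
  moreover have "(breg pow pow1 e \<longlongrightarrow> breg pow pow1 e 0) (at_right 0)"
    unfolding breg_def[abs_def] pow_def by (intro tendsto_intros)
  ultimately have "filterlim (\<lambda>x. breg pow pow1 e x * (- ent1 e + ent1 x)) at_top (at_right 0)"
    using breg_pow_pos(2)[OF assms] by (intro filterlim_tendsto_pos_mult_at_top)
  moreover have ent_lim: "(ent \<longlongrightarrow> 0) (at_right 0)"
    unfolding ent_def[abs_def] S0_def by real_asymp
  have "((\<lambda>x. - ((pow1 x - pow1 e) * breg ent ent1 e x)) \<longlongrightarrow>
      - ((pow1 0 - pow1 e) * (0 - ent e - ent1 e * (0 - e)))) (at_right 0)"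
    unfolding breg_def[abs_def] pow1_def by (intro tendsto_intros ent_lim)
  ultimately have "filterlim (\<lambda>x. - ((pow1 x - pow1 e) * breg ent ent1 e x)
      + breg pow pow1 e x * (- ent1 e + ent1 x)) at_top (at_right 0)"
    by (intro filterlim_tendsto_add_at_top)
  then show ?thesis by (simp add: tangency_def[abs_def] algebra_simps)
qed

text \<open>The infinite limits at the endpoints furnish \<open>right_neg\<close> and
  \<open>left_pos\<close>, the latter after exchanging the arguments.\<close>

lemma entropy_power_conjugation:
  "unimodal_conjugation ent ent1 ent2 pow pow1 pow2 0 1 peak"
proof
  show "\<exists>x>peak. x < 1 \<and> tangency ent ent1 pow pow1 e x < 0" if "0 < e" "e < peak" for e
  proof -
    have "\<forall>\<^sub>F x in at_left 1. tangency ent ent1 pow pow1 e x < 0"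
      using tangency_at_1[of e] that peak by (simp add: filterlim_at_bot_dense)
    moreover have "\<forall>\<^sub>F x in at_left 1. x \<in> {peak<..<1}"
      by (rule eventually_at_leftI[OF _ peak(2)]) simp
    ultimately have "\<forall>\<^sub>F x in at_left (1::real). x > peak \<and> x < 1 \<and> tangency ent ent1 pow pow1 e x < 0"
      by eventually_elim simp
    then show ?thesis using eventually_happens trivial_limit_at_left_real by blast
  qed
  show "\<exists>e>0. e < peak \<and> tangency ent ent1 pow pow1 e x > 0" if "peak < x" "x < 1" for x
  proof -
    have "\<forall>\<^sub>F e in at_right 0. tangency ent ent1 pow pow1 x e > 0"
      using tangency_at_0[of x] that peak by (simp add: filterlim_at_top_dense)
    moreover have "\<forall>\<^sub>F e in at_right 0. e \<in> {0<..<peak}"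
      by (rule eventually_at_rightI[OF _ peak(1)]) simp
    ultimately have "\<forall>\<^sub>F e in at_right (0::real). e > 0 \<and> e < peak \<and> tangency ent ent1 pow pow1 e x > 0"
      by eventually_elim (simp add: tangency_commute)
    then show ?thesis using eventually_happens trivial_limit_at_right_real by blast
  qed
qed (use peak ent ent1 pow pow1 pow2_pos ratio_inc ratio_dec in auto)

section \<open>Transfer to \<open>psi\<close> and \<open>zeta\<close>\<close>

interpretation unimodal_conjugation ent ent1 ent2 pow pow1 pow2 0 1 peak
  by (rule entropy_power_conjugation)

text \<open>The equality holds for every real second argument, so derivatives in that argument carry
  over directly.\<close>

lemma psi_eq_Q:
  assumes "0 < e" "e < 1"
  shows "psi (n + 2) e = Q e"
proof -
  have S0: "(S0 has_real_derivative ent1 w / 2) (at w)" if "0 < w" "w < 1" for w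
    using DERIV_cdivide[OF ent[OF that], of 2] by (simp add: ent_def)
  have deriv_S0: "deriv S0 w = ent1 w / 2" if "0 < w" "w < 1" for w
    by (rule DERIV_imp_deriv) (rule S0[OF that])
  \<comment> \<open>The second derivative requires the formula for \<open>deriv S0\<close> on a
    neighbourhood of \<open>e\<close>, not just at \<open>e\<close>.\<close>
  have "(deriv S0 has_real_derivative ent2 e / 2) (at e)"
    by (rule has_field_derivative_transform_within_open[where S="{0<..<1}",
          OF DERIV_cdivide[OF ent1[OF assms]]])
       (use assms in \<open>simp_all add: deriv_S0\<close>)
  then have "deriv (deriv S0) e = ent2 e / 2" by (rule DERIV_imp_deriv)
  note d = this deriv_S0[OF assms]
  have num: "2 * (S0 x - S0 e - ent1 e / 2 * (x - e)) = ent x - ent e - ent1 e * (x - e)" for x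
    by (simp add: ent_def field_simps)
  show ?thesis
    unfolding psi_def d num
    by (rule ext) (simp add: Q_def breg_def pow_def pow1_def pow2_def add.commute)
qed

text \<open>Off the diagonal, stationarity is a zero of \<open>H\<close>; on it, a third of the
  slope of the ratio vanishes only at \<open>peak\<close>, which matches the extra clause of
  \<open>conjugate\<close>.\<close>

lemma critical_iff_conjugate:
  assumes "0 < e" "e < 1" "0 < z" "z < 1"
  shows "critical (n + 2) e z \<longleftrightarrow> conjugate e z"
proof (cases "z = e")
  case False
  then show ?thesis using Q_stationary_off_diagonal assms
    by (simp add: critical_def psi_eq_Q conjugate_def del: add_2_eq_Suc')
next
  case True
  have "isCont pow2 e" unfolding pow2_def[abs_def] by (intro continuous_intros)
  then have "(Q e has_real_derivative - (e - peak) * slope e / 3) (at e)"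
    using Q_has_real_derivative_diagonal ratio_deriv assms by blast
  then have "(Q e has_real_derivative 0) (at e) \<longleftrightarrow> - (e - peak) * slope e / 3 = 0"
    using DERIV_unique by metis
  also have "\<dots> \<longleftrightarrow> e = peak" using slope_pos[of e] assms by auto
  finally show ?thesis using True assms
    by (simp add: critical_def psi_eq_Q conjugate_def del: add_2_eq_Suc')
qed

lemma zeta_eq_Z:
  assumes "0 < e" "e < 1"
  shows "zeta (n + 2) e = Z e"
  unfolding zeta_def Z_def using critical_iff_conjugate[OF assms]
  by (intro arg_cong[where f=The] ext) (auto simp: conjugate_def)

lemma zeta_deriv:
  assumes "0 < e" "e < 1"
  shows "\<exists>d. d \<noteq> 0 \<and> (zeta (n + 2) has_real_derivative d) (at e)"
proof -
  have "\<exists>d. d \<noteq> 0 \<and> (Z has_real_derivative d) (at e)"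
  proof (cases "e = peak")
    case True
    have "(Z has_real_derivative - 1) (at peak)"
      by (rule Z_deriv_fixed_point[OF pow2_lipschitz ratio_deriv isCont_slope[OF peak] slope_pos[OF peak]])
    then show ?thesis unfolding True by (intro exI[of _ "- 1"]) simp
  qed (use Z_deriv_off_diagonal assms in simp)
  then obtain d where "d \<noteq> 0" "(Z has_real_derivative d) (at e)" by blast
  \<comment> \<open>\<open>zeta\<close> agrees with \<open>Z\<close> on the open unit interval, and
    differentiation is local.\<close>
  moreover from this(2) have "(zeta (n + 2) has_real_derivative d) (at e)"
    by (rule has_field_derivative_transform_within_open[where S="{0<..<1}"])
       (use assms in \<open>auto simp: zeta_eq_Z simp del: add_2_eq_Suc'\<close>)
  ultimately show ?thesis by blast
qed

end

theorem theorem3p3: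
  fixes k :: nat
  assumes "k \<ge> 2"
  shows "(\<forall>e\<in>{0<..<1}. \<exists>!e'. e' \<in> {0<..<1} \<and> critical k e e')
    \<and> zeta k ` {0<..<1} \<subseteq> {0<..<1}
    \<and> strict_antimono_on {0<..<1} (zeta k)
    \<and> (\<forall>e\<in>{0<..<1}. zeta k differentiable (at e) \<and> deriv (zeta k) e \<noteq> 0)
    \<and> (\<forall>e\<in>{0<..<1}. zeta k e = e \<longleftrightarrow> e = (real k - 1) / real k)
    \<and> (\<forall>e\<in>{0<..<1}. \<forall>e'\<in>{0<..<1}. e' = zeta k e \<longleftrightarrow> e = zeta k e')"
proof -
  define n where "n = k - 2"
  have k: "k = n + 2" using assms by (simp add: n_def)
  interpret unimodal_conjugation ent ent1 ent2 "pow n" "pow1 n" "pow2 n" 0 1 "peak n"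
    by (rule entropy_power_conjugation)
  have peak_k: "peak n = (real k - 1) / real k" by (simp add: k peak_def add.commute)
  note zeta = zeta_eq_Z[of _ n, folded k]
  show ?thesis
  proof (intro conjI ballI)
    fix e :: real assume e: "e \<in> {0<..<1}"
    show "\<exists>!e'. e' \<in> {0<..<1} \<and> critical k e e'"
      using ex1_conjugate[of e] critical_iff_conjugate[of e _ n, folded k] e
      by (auto simp: conjugate_def)
    have "\<exists>d. d \<noteq> 0 \<and> (zeta k has_real_derivative d) (at e)"
      using zeta_deriv[of e n, folded k] e by simp
    then show "zeta k differentiable (at e)" "deriv (zeta k) e \<noteq> 0"
      by (auto simp: real_differentiable_def DERIV_imp_deriv)
    show "zeta k e = e \<longleftrightarrow> e = (real k - 1) / real k"
      using Z_fixed_iff[of e] e by (simp add: zeta peak_k)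
    fix e' :: real assume e': "e' \<in> {0<..<1}"
    show "e' = zeta k e \<longleftrightarrow> e = zeta k e'"
      using Z_involution[of e] Z_involution[of e'] e e' by (auto simp: zeta)
  next
    show "zeta k ` {0<..<1} \<subseteq> {0<..<1}" using Z_in by (auto simp: zeta)
    show "strict_antimono_on {0<..<1} (zeta k)"
      using Z_strict_antimono by (auto simp: monotone_on_def zeta)
  qed
qed

end
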